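(* Let $n\in\mathbb{P}$ and let $I,J\subseteq[n-1]$ be unmixed, i.e. $I\cap J=(I+1)\cap J=I\cap(J+1)=\emptyset$. Let $I_1,\ldots,I_s$ be the connected components of $I$ and $J_1,\ldots,J_t$ the connected components of $J$. Put $b_j:=\lfloor (|I_j|+1)/2\rfloor$ for $j=1,\ldots,s$, $d_k:=\lfloor (|J_k|+1)/2\rfloor$ for $k=1,\ldots,t$, $\tilde b:=\sum_{j=1}^s b_j$, $\tilde d:=\sum_{k=1}^t d_k$, $M:=\tilde b+\tilde d$, and $\alpha(J):=\sum_{k=1}^t d_k^2$. Then $$\sum_{\sigma\in\mathcal{D}^I_J(S_n)}(-1)^{\ell(\sigma)}x^{L(\sigma)}=\begin{cases}(-1)^{\tilde d}\,x^{\alpha(J)}\,\dfrac{x^{\tilde d}[\tilde b]_{x^2}+x^{\tilde b}[\tilde d]_{x^2}}{[M]_{x^2}}\left[\begin{matrix}M\\ b_1,\ldots,b_s,d_1,\ldots,d_t\end{matrix}\right]_{x^2}, & \text{if } n=2M,\\[2ex] (-x)^{\tilde d}\,x^{\alpha(J)}\left[\begin{matrix}M\\ b_1,\ldots,b_s,d_1,\ldots,d_t\end{matrix}\right]_{x^2}\displaystyle\prod_{k=2M+2}^{n}\bigl(1+(-1)^{k-1}x^{\lfloor k/2\rfloor}\bigr), & \text{otherwise.}\end{cases}$$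
   Context: For integers $a\le b$, $[a,b]=\{a,a+1,\ldots,b\}$ and $[n]=[1,n]$; $\mathbb{P}$ denotes the positive integers. For $A\subseteq\mathbb{Z}$, $A+1=\{a+1:a\in A\}$. Every $K\subseteq[n-1]$ is uniquely a union $[a_1,b_1]\cup\cdots\cup[a_r,b_r]$ with $b_i+1<a_{i+1}$; these intervals are the connected components of $K$. $S_n$ is the symmetric group on $[n]$. For $\sigma\in S_n$: $\ell(\sigma)=|\{(i,j):i<j,\ \sigma(i)>\sigma(j)\}|$ (number of inversions), $L(\sigma)=|\{(i,j):i<j,\ \sigma(i)>\sigma(j),\ i\not\equiv j \pmod 2\}|$ (odd length), and $D(\sigma)=\{i\in[n-1]:\sigma(i)>\sigma(i+1)\}$. For disjoint $I,J\subseteq[n-1]$, $\mathcal{D}^I_J(S_n):=\{\sigma\in S_n: J\subseteq D(\sigma)\subseteq[n-1]\setminus I\}$ (so $\sigma(i)<\sigma(i+1)$ for $i\in I$ and $\sigma(i)>\sigma(i+1)$ for $i\in J$). For $m\in\mathbb{N}$, $[m]_q=(1-q^m)/(1-q)$, $[m]_q!=\prod_{i=1}^m[i]_q$, and for $n_1+\cdots+n_k=N$, $\left[\begin{matrix}N\\ n_1,\ldots,n_k\end{matrix}\right]_q=\frac{[N]_q!}{[n_1]_q!\cdots[n_k]_q!}$. *)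

theory Defs
  imports
    "HOL-Combinatorics.Permutations"
    "HOL-Computational_Algebra.Polynomial_Factorial"
begin

definition inv_length :: "nat \<Rightarrow> (nat \<Rightarrow> nat) \<Rightarrow> nat" where
  "inv_length n \<sigma> = card {(i, j). i \<in> {1..n} \<and> j \<in> {1..n} \<and> i < j \<and> \<sigma> i > \<sigma> j}"

definition odd_length :: "nat \<Rightarrow> (nat \<Rightarrow> nat) \<Rightarrow> nat" where
  "odd_length n \<sigma> =
     card {(i, j). i \<in> {1..n} \<and> j \<in> {1..n} \<and> i < j \<and> \<sigma> i > \<sigma> j \<and> i mod 2 \<noteq> j mod 2}"

definition descents :: "nat \<Rightarrow> (nat \<Rightarrow> nat) \<Rightarrow> nat set" where
  "descents n \<sigma> = {i \<in> {1..n - 1}. \<sigma> i > \<sigma> (i + 1)}"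

definition descent_class :: "nat \<Rightarrow> nat set \<Rightarrow> nat set \<Rightarrow> (nat \<Rightarrow> nat) set" where
  "descent_class n I J =
     {\<sigma>. \<sigma> permutes {1..n} \<and> J \<subseteq> descents n \<sigma> \<and> descents n \<sigma> \<subseteq> {1..n - 1} - I}"

definition unmixed :: "nat set \<Rightarrow> nat set \<Rightarrow> bool" where
  "unmixed I J \<longleftrightarrow> I \<inter> J = {} \<and> (\<lambda>i. i + 1) ` I \<inter> J = {} \<and> I \<inter> (\<lambda>j. j + 1) ` J = {}"

definition interval_decomp :: "nat set \<Rightarrow> (nat \<times> nat) list \<Rightarrow> bool" where
  "interval_decomp K ivs \<longleftrightarrow>
     K = (\<Union>(a, b) \<in> set ivs. {a..b}) \<and>
     (\<forall>(a, b) \<in> set ivs. a \<le> b) \<and>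
     successively (\<lambda>(a, b) (a', b'). b + 1 < a') ivs"

text \<open>\<open>Ks\<close> lists the connected components of \<open>K\<close> from left to right.  For finite \<open>K\<close> there
  is exactly one such list, see \<open>connected_components_ex1\<close> below.\<close>

definition connected_components :: "nat set \<Rightarrow> nat set list \<Rightarrow> bool" where
  "connected_components K Ks \<longleftrightarrow>
     (\<exists>ivs. interval_decomp K ivs \<and> Ks = map (\<lambda>(a, b). {a..b}) ivs)"

definition q_int :: "'a::field \<Rightarrow> nat \<Rightarrow> 'a" where
  "q_int q m = (1 - q ^ m) / (1 - q)"

definition q_fact :: "'a::field \<Rightarrow> nat \<Rightarrow> 'a" where
  "q_fact q m = (\<Prod>i = 1..m. q_int q i)"

text \<open>Only meaningful when \<open>N\<close> is the sum of the list.\<close>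

definition q_multinomial :: "'a::field \<Rightarrow> nat \<Rightarrow> nat list \<Rightarrow> 'a" where
  "q_multinomial q N ns = q_fact q N / (\<Prod>m\<leftarrow>ns. q_fact q m)"

text \<open>The indeterminate, in the field of fractions of the integer polynomials, so that the
  quotients in the q-analogues are genuine divisions by nonzero elements.\<close>

definition xvar :: "int poly fract" where
  "xvar = to_fract [:0, 1:]"

lemma interval_decomp_Nil: "interval_decomp K [] \<longleftrightarrow> K = {}"
  by (simp add: interval_decomp_def)

lemma interval_decomp_tail_gt:
  fixes ivs :: "(nat \<times> nat) list"
  assumes "\<forall>(a, b) \<in> set ((a, b) # ivs). a \<le> b"
    and "successively (\<lambda>(a, b) (a', b'). b + 1 < a') ((a, b) # ivs)"
    and "x \<in> (\<Union>(a, b) \<in> set ivs. {a..b})"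
  shows "b + 1 < x"
  using assms
proof (induction ivs arbitrary: a b)
  case (Cons c ivs)
  obtain a' b' where c: "c = (a', b')" by force
  from Cons.prems c have le: "a' \<le> b'" and lt: "b + 1 < a'" by auto
  show ?case
  proof (cases "x \<in> {a'..b'}")
    case False
    with Cons.prems c have "b' + 1 < x"
      by (intro Cons.IH[of a' b']) (auto simp: successively_Cons)
    with le lt show ?thesis by simp
  qed (use lt in auto)
qed simp

lemma interval_decomp_Cons:
  "interval_decomp K ((a, b) # ivs) \<longleftrightarrow>
     a \<le> b \<and> {a..b} \<subseteq> K \<and> (\<forall>x \<in> K - {a..b}. b + 1 < x) \<and> interval_decomp (K - {a..b}) ivs"
  (is "?L \<longleftrightarrow> ?R")
proof
  assume L: ?L
  let ?U = "\<Union>(a, b) \<in> set ivs. {a..b}"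
  from L have K: "K = {a..b} \<union> ?U" and le: "a \<le> b"
    by (auto simp: interval_decomp_def)
  have gt: "b + 1 < x" if "x \<in> ?U" for x
    using interval_decomp_tail_gt[of a b ivs x] L that unfolding interval_decomp_def by blast
  have "K - {a..b} = ?U"
    using gt unfolding K by fastforce
  moreover have "\<forall>(a, b) \<in> set ivs. a \<le> b" "successively (\<lambda>(a, b) (a', b'). b + 1 < a') ivs"
    using L by (auto simp: interval_decomp_def successively_Cons split: list.splits)
  ultimately show ?R
    using gt le K by (auto simp: interval_decomp_def)
next
  assume R: ?R
  let ?U = "\<Union>(a, b) \<in> set ivs. {a..b}"
  have U: "K - {a..b} = ?U" and "\<forall>(a, b) \<in> set ivs. a \<le> b"
    and s: "successively (\<lambda>(a, b) (a', b'). b + 1 < a') ivs"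
    using R by (auto simp: interval_decomp_def)
  moreover have "K = {a..b} \<union> ?U" using R U by blast
  moreover have "successively (\<lambda>(a, b) (a', b'). b + 1 < a') ((a, b) # ivs)"
  proof (cases ivs)
    case (Cons c cs)
    obtain a' b' where c: "c = (a', b')" by force
    with Cons calculation(2) have "a' \<in> ?U" by auto
    with R U have "b + 1 < a'" by blast
    with s Cons c show ?thesis by simp
  qed simp
  ultimately show ?L
    using R unfolding interval_decomp_def by auto
qed

lemma interval_decomp_unique:
  "interval_decomp K xs \<Longrightarrow> interval_decomp K ys \<Longrightarrow> xs = ys"
proof (induction xs arbitrary: K ys)
  case Nil
  then have "K = {}" by (simp add: interval_decomp_Nil)
  with Nil(2) show ?case
    by (cases ys) (auto simp: interval_decomp_Cons)
next
  case (Cons c xs)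
  obtain a b where c: "c = (a, b)" by force
  from Cons.prems(1) c have x: "a \<le> b" "{a..b} \<subseteq> K" "\<forall>x \<in> K - {a..b}. b + 1 < x"
    "interval_decomp (K - {a..b}) xs" by (auto simp: interval_decomp_Cons)
  then have "K \<noteq> {}" by auto
  with Cons.prems(2) obtain a' b' zs where ys: "ys = (a', b') # zs"
    by (cases ys) (auto simp: interval_decomp_Nil)
  with Cons.prems(2) have y: "a' \<le> b'" "{a'..b'} \<subseteq> K" "\<forall>x \<in> K - {a'..b'}. b' + 1 < x"
    "interval_decomp (K - {a'..b'}) zs" by (auto simp: interval_decomp_Cons)
  have "a \<in> K" "a' \<in> K" using x y by auto
  have "a \<le> a'"
    using x(1) bspec[OF x(3), of a'] \<open>a' \<in> K\<close> by (cases "a' \<in> {a..b}") auto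
  moreover have "a' \<le> a"
    using y(1) bspec[OF y(3), of a] \<open>a \<in> K\<close> by (cases "a \<in> {a'..b'}") auto
  ultimately have a: "a' = a" by simp
  have "b + 1 \<notin> K" "b' + 1 \<notin> K" using x(3) y(3) by fastforce+
  then have "b + 1 \<notin> {a..b'}" "b' + 1 \<notin> {a..b}" using x(2) y(2) a by blast+
  then have "b' = b" using x(1) y(1) a by simp
  with a ys c Cons.IH x(4) y(4) show ?case by simp
qed

lemma interval_decomp_exists:
  "finite K \<Longrightarrow> \<exists>xs. interval_decomp K xs"
proof (induction K rule: finite_psubset_induct)
  case (psubset K)
  show ?case
  proof (cases "K = {}")
    case False
    define a where "a = Min K"
    have a: "a \<in> K" "\<And>x. x \<in> K \<Longrightarrow> a \<le> x"
      using psubset(1) False by (auto simp: a_def)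
    define B where "B = {b. a \<le> b \<and> {a..b} \<subseteq> K}"
    have "B \<subseteq> K" by (auto simp: B_def)
    then have fB: "finite B" using psubset(1) finite_subset by blast
    have "a \<in> B" using a by (simp add: B_def)
    define b where "b = Max B"
    have "b \<in> B" unfolding b_def using fB \<open>a \<in> B\<close> by (intro Max_in) blast+
    then have b: "a \<le> b" "{a..b} \<subseteq> K" by (auto simp: B_def)
    have "b + 1 \<notin> B" using Max_ge[OF fB, of "b + 1"] unfolding b_def by linarith
    moreover have "{a..b + 1} = insert (b + 1) {a..b}" using b(1) by auto
    ultimately have nb: "b + 1 \<notin> K" using b by (auto simp: B_def)
    have gt: "b + 1 < x" if "x \<in> K - {a..b}" for x
      using that a(2)[of x] nb by (cases "x = b + 1") auto
    have "K - {a..b} \<subset> K" using a(1) b(1) by auto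
    then obtain xs where "interval_decomp (K - {a..b}) xs" using psubset(2) by blast
    with b gt have "interval_decomp K ((a, b) # xs)" by (auto simp: interval_decomp_Cons)
    then show ?thesis by blast
  qed (use interval_decomp_Nil in blast)
qed

lemma connected_components_ex1:
  assumes "finite K"
  shows "\<exists>!Ks. connected_components K Ks"
  using interval_decomp_exists[OF assms] interval_decomp_unique
  unfolding connected_components_def by metis

end

theory Submission
  imports Defs
begin

text \<open>Exchanging the entries in two positions of equal parity reverses the sign and changes the odd
  length by twice the number of entries of opposite position parity that lie between them in position
  and in value. Such exchanges have three consequences. Among three consecutive positions without
  constraints, peaks and valleys cancel, so a constrained pair may be moved past a free position, and
  next to a free position a descent pair equals \<open>- x\<^sup>2\<close> times an ascent pair. An ascent pair followed
  by an ascending block of length \<open>t\<close> can be merged into one block at the cost of the factor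
  \<open>[\<lfloor>t/2\<rfloor> + 1]\<close> at \<open>x\<^sup>2\<close>; complementation gives the same for descents with \<open>1/x\<close> in place of \<open>x\<close>. Hence
  every class reduces to one whose components are isolated pairs. If some position is free, all pairs
  can be turned into ascents and pushed to the left, which yields the product formula. If no position
  is free, the value follows by induction on the number of descent pairs, since an ascent pair and a
  descent pair in the same place add up to two free positions.\<close>

subsection \<open>Exchanging two positions of equal parity\<close>

text \<open>To \<open>odd_length\<close>, two positions of equal parity look alike: any third
  position is of opposite parity to both or to neither. This makes the effect of an exchange
  computable, and it explains the \<open>t div 2\<close>: only every second position of a block can
  be exchanged with the first entry of a pair. The shift and flip relations need a position outside
  all pairs. In the tight case \<open>n = 2 * M\<close> there is none, descents cannot be traded for
  ascents, and the value is governed by a sum of two terms instead of a product over the free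
  positions. In the other case, turning two of at least three free positions into an ascent pair
  costs \<open>1 - x ^ 2\<close>; with the new factor of the q-factorial this makes
  \<open>1 - x ^ (2 * (M + 1))\<close>, which splits into two consecutive factors of the product.
  The exponent \<alpha> sums \<open>e * (e - 1) + e\<close> over the components of \<open>J\<close>:
  the first summand converts a q-factorial from \<open>1/x\<close> to \<open>x\<close>, the second
  is contributed by the descent pairs themselves.\<close>

definition inversions_on :: "(nat \<Rightarrow> nat \<Rightarrow> bool) \<Rightarrow> nat \<Rightarrow> (nat \<Rightarrow> nat) \<Rightarrow> nat" where
  "inversions_on Q n \<sigma> = (\<Sum>i\<in>{1..n}. \<Sum>j\<in>{1..n}. of_bool (i < j \<and> \<sigma> j < \<sigma> i \<and> Q i j))"

lemma card_pairs_eq_sum: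
  assumes "finite A"
  shows "card {(i, j). i \<in> A \<and> j \<in> A \<and> P i j} = (\<Sum>i\<in>A. \<Sum>j\<in>A. of_bool (P i j))"
proof -
  have "{(i, j). i \<in> A \<and> j \<in> A \<and> P i j} = (SIGMA i:A. {j \<in> A. P i j})"
    by auto
  then show ?thesis
    using assms by (simp add: Collect_conj_eq[symmetric] Int_def conj_commute)
qed

lemma inv_length_eq: "inv_length n \<sigma> = inversions_on (\<lambda>_ _. True) n \<sigma>"
  using card_pairs_eq_sum[of "{1..n}" "\<lambda>i j. i < j \<and> \<sigma> j < \<sigma> i"]
  by (simp add: inv_length_def inversions_on_def)

lemma odd_length_eq: "odd_length n \<sigma> = inversions_on (\<lambda>i j. i mod 2 \<noteq> j mod 2) n \<sigma>"
  using card_pairs_eq_sum[of "{1..n}" "\<lambda>i j. i < j \<and> \<sigma> j < \<sigma> i \<and> i mod 2 \<noteq> j mod 2"]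
  by (simp add: odd_length_def inversions_on_def)

text \<open>A relation \<open>Q\<close> covers both lengths; what matters is that it is symmetric
  and does not tell \<open>p\<close> from \<open>r\<close>. A third position \<open>q\<close> sees
  the same two values at the two ends, in exchanged order, so its contribution changes only if it
  lies between them in position and in value. There it gains an inversion with each end, whence the
  factor 2.\<close>

lemma inversions_on_transpose:
  assumes pr: "p < r" "p \<in> {1..n}" "r \<in> {1..n}" and less: "\<sigma> p < \<sigma> r" and inj: "inj \<sigma>"
    and sym: "\<And>i j. Q i j = Q j i" and Q: "\<And>q. q \<noteq> p \<Longrightarrow> q \<noteq> r \<Longrightarrow> Q q p = Q q r"
  shows "inversions_on Q n (\<sigma> \<circ> transpose p r) = inversions_on Q n \<sigma> + of_bool (Q p r)
    + 2 * card {q. p < q \<and> q < r \<and> Q p q \<and> \<sigma> p < \<sigma> q \<and> \<sigma> q < \<sigma> r}"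
proof -
  define S where "S = {1..n} - {p, r}"
  define f where "f = (\<lambda>(\<sigma> :: nat \<Rightarrow> nat) i j. of_bool (i < j \<and> \<sigma> j < \<sigma> i \<and> Q i j) :: nat)"
  define g where "g = (\<lambda>\<sigma> q. f \<sigma> p q + f \<sigma> q p + f \<sigma> r q + f \<sigma> q r)"
  let ?\<tau> = "\<sigma> \<circ> transpose p r"
  have [simp]: "finite S" "p \<notin> S" "r \<notin> S" and n: "{1..n} = insert p (insert r S)"
    using pr by (auto simp: S_def)
  have split: "inversions_on Q n \<rho> = (\<Sum>i\<in>S. \<Sum>j\<in>S. f \<rho> i j) + (\<Sum>q\<in>S. g \<rho> q) + f \<rho> p r" for \<rho>
  proof -
    have [simp]: "f \<rho> p p = 0" "f \<rho> r r = 0" "f \<rho> r p = 0" using pr(1) by (auto simp: f_def)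
    have "inversions_on Q n \<rho> = (\<Sum>i\<in>insert p (insert r S). \<Sum>j\<in>insert p (insert r S). f \<rho> i j)"
      by (simp only: inversions_on_def n f_def)
    then show ?thesis using pr(1) by (simp add: sum.distrib g_def)
  qed
  have "(\<Sum>i\<in>S. \<Sum>j\<in>S. f ?\<tau> i j) = (\<Sum>i\<in>S. \<Sum>j\<in>S. f \<sigma> i j)"
    by (intro sum.cong refl) (auto simp: f_def S_def)
  moreover have "(\<Sum>q\<in>S. g ?\<tau> q) = (\<Sum>q\<in>S. g \<sigma> q) +
      2 * card {q. p < q \<and> q < r \<and> Q p q \<and> \<sigma> p < \<sigma> q \<and> \<sigma> q < \<sigma> r}"
  proof -
    let ?B = "\<lambda>q. p < q \<and> q < r \<and> Q p q \<and> \<sigma> p < \<sigma> q \<and> \<sigma> q < \<sigma> r"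
    have "g ?\<tau> q = g \<sigma> q + 2 * of_bool (?B q)" if "q \<in> S" for q
    proof -
      have q: "q \<noteq> p" "q \<noteq> r" using that by (auto simp: S_def)
      then have v: "\<sigma> q \<noteq> \<sigma> p" "\<sigma> q \<noteq> \<sigma> r" using inj by (auto dest: injD)
      have [simp]: "Q q r = Q p q" "Q r q = Q p q" "Q q p = Q p q"
        using Q[OF q] sym by blast+
      have [simp]: "?\<tau> p = \<sigma> r" "?\<tau> r = \<sigma> p" "?\<tau> q = \<sigma> q" using q by auto
      consider "q < p" | "p < q" "q < r" | "r < q" using q by linarith
      then show ?thesis
        by cases (use pr(1) less v in \<open>auto simp: g_def f_def simp del: o_apply\<close>)
    qed
    then have "(\<Sum>q\<in>S. g ?\<tau> q) = (\<Sum>q\<in>S. g \<sigma> q) + 2 * (\<Sum>q\<in>S. of_bool (?B q))"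
      by (simp add: sum.distrib sum_distrib_left)
    also have "(\<Sum>q\<in>S. of_bool (?B q)) = card {q. ?B q}"
      using pr by (auto simp: S_def intro!: arg_cong[where f = card])
    finally show ?thesis .
  qed
  moreover have "f ?\<tau> p r = f \<sigma> p r + of_bool (Q p r)"
    using pr less by (simp add: f_def)
  ultimately show ?thesis by (simp add: split)
qed

definition signed_weight :: "'a::field \<Rightarrow> nat \<Rightarrow> (nat \<Rightarrow> nat) \<Rightarrow> 'a" where
  "signed_weight x n \<sigma> = (- 1) ^ inv_length n \<sigma> * x ^ odd_length n \<sigma>"

text \<open>The pair \<open>p\<close>, \<open>r\<close> itself counts for \<open>inv_length\<close>
  but not for \<open>odd_length\<close>: the number of inversions changes by an odd amount, which
  gives the minus sign, and the exponent of \<open>x\<close> by an even one.\<close>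

lemma signed_weight_transpose:
  assumes pr: "p < r" "p \<in> {1..n}" "r \<in> {1..n}" "p mod 2 = r mod 2" and "\<sigma> p < \<sigma> r" "inj \<sigma>"
  shows "signed_weight x n (\<sigma> \<circ> transpose p r) =
    - (x ^ (2 * card {q. p < q \<and> q < r \<and> p mod 2 \<noteq> q mod 2 \<and> \<sigma> p < \<sigma> q \<and> \<sigma> q < \<sigma> r}))
      * signed_weight x n \<sigma>"
proof -
  have "odd_length n (\<sigma> \<circ> transpose p r) = odd_length n \<sigma> +
     2 * card {q. p < q \<and> q < r \<and> p mod 2 \<noteq> q mod 2 \<and> \<sigma> p < \<sigma> q \<and> \<sigma> q < \<sigma> r}"
    unfolding odd_length_eq by (subst inversions_on_transpose) (use assms in auto)
  moreover have "inv_length n (\<sigma> \<circ> transpose p r) = inv_length n \<sigma> + 1 +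
     2 * card {q. p < q \<and> q < r \<and> \<sigma> p < \<sigma> q \<and> \<sigma> q < \<sigma> r}"
    unfolding inv_length_eq by (subst inversions_on_transpose) (use assms in auto)
  ultimately show ?thesis
    by (simp add: signed_weight_def power_add power_mult)
qed

definition ascent_class :: "nat \<Rightarrow> nat set \<Rightarrow> nat set \<Rightarrow> (nat \<Rightarrow> nat) set" where
  "ascent_class n I J = {\<sigma>. \<sigma> permutes {1..n} \<and> (\<forall>i\<in>I. \<sigma> i < \<sigma> (i + 1)) \<and> (\<forall>i\<in>J. \<sigma> (i + 1) < \<sigma> i)}"

text \<open>The variable is an arbitrary field element because complementation evaluates the same
  sum at \<open>inverse x\<close>.\<close>

definition class_gf :: "'a::field \<Rightarrow> nat \<Rightarrow> nat set \<Rightarrow> nat set \<Rightarrow> 'a" where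
  "class_gf x n I J = (\<Sum>\<sigma>\<in>ascent_class n I J. signed_weight x n \<sigma>)"

lemma descent_class_eq:
  assumes "I \<subseteq> {1..n - 1}" "J \<subseteq> {1..n - 1}"
  shows "descent_class n I J = ascent_class n I J"
proof -
  have "\<sigma> i < \<sigma> (i + 1) \<longleftrightarrow> \<not> \<sigma> (i + 1) < \<sigma> i" if "\<sigma> permutes {1..n}" for \<sigma> i
    using permutes_inj[OF that] by (metis inj_eq linorder_neqE_nat not_less_iff_gr_or_eq n_not_Suc_n Suc_eq_plus1)
  then show ?thesis
    using assms unfolding descent_class_def ascent_class_def descents_def by blast
qed

lemma ascent_class_perm: "\<sigma> \<in> ascent_class n I J \<Longrightarrow> \<sigma> permutes {1..n}"
  by (simp add: ascent_class_def)

lemma ascent_class_inj: "\<sigma> \<in> ascent_class n I J \<Longrightarrow> inj \<sigma>"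
  using permutes_inj ascent_class_perm by blast

lemma finite_ascent_class [simp]: "finite (ascent_class n I J)"
  using finite_permutations[of "{1..n}"] by (auto simp: ascent_class_def intro: rev_finite_subset)

text \<open>An injective map ascends or descends at every index. Combined with the vanishing of
  peaks and valleys this gives the shift relations.\<close>

lemma class_gf_split: "class_gf x n I J = class_gf x n (insert i I) J + class_gf x n I (insert i J)"
proof -
  have neq: "\<sigma> i < \<sigma> (Suc i) \<or> \<sigma> (Suc i) < \<sigma> i" if "\<sigma> permutes {Suc 0..n}" for \<sigma>
    using permutes_inj[OF that] by (metis inj_eq linorder_neqE_nat n_not_Suc_n)
  have "ascent_class n I J = ascent_class n (insert i I) J \<union> ascent_class n I (insert i J)"
    using neq by (auto simp: ascent_class_def)
  moreover have "ascent_class n (insert i I) J \<inter> ascent_class n I (insert i J) = {}"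
    by (auto simp: ascent_class_def)
  ultimately show ?thesis
    unfolding class_gf_def by (simp add: sum.union_disjoint)
qed

text \<open>A condition at \<open>i\<close> reads the positions \<open>i\<close> and
  \<open>i + 1\<close>. To rearrange the positions \<open>a..b\<close>, the indices
  \<open>a - 1..b\<close> must therefore carry no condition; this is the source of the sets
  \<open>{p - 1..p + 2}\<close> below.\<close>

lemma ascent_class_transpose:
  assumes "\<sigma> \<in> ascent_class n I J" "u \<in> {a..b}" "v \<in> {a..b}" "1 \<le> a" "b \<le> n"
    and "(I \<union> J) \<inter> {a - 1..b} = {}"
  shows "\<sigma> \<circ> transpose u v \<in> ascent_class n I J"
proof -
  have "\<sigma> \<circ> transpose u v permutes {1..n}"
    using assms by (intro permutes_compose permutes_swap_id ascent_class_perm) auto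
  moreover have "transpose u v i = i \<and> transpose u v (i + 1) = i + 1" if "i \<in> I \<union> J" for i
  proof -
    have "i \<notin> {a - 1..b}" using that assms(6) by blast
    then show ?thesis using assms(2-4) by (auto simp: transpose_def)
  qed
  ultimately show ?thesis
    using assms(1) by (auto simp: ascent_class_def)
qed

lemma sum_signed_weight_transpose:
  assumes "p < r" "p \<in> {1..n}" "r \<in> {1..n}" "p mod 2 = r mod 2"
    and "\<And>\<sigma>. \<sigma> \<in> A \<Longrightarrow> inj \<sigma> \<and> \<sigma> p < \<sigma> r \<and> \<sigma> \<circ> transpose p r \<in> B"
    and "\<And>\<sigma>. \<sigma> \<in> B \<Longrightarrow> \<sigma> \<circ> transpose p r \<in> A"
    and "\<And>\<sigma>. \<sigma> \<in> A \<Longrightarrow>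
      card {q. p < q \<and> q < r \<and> p mod 2 \<noteq> q mod 2 \<and> \<sigma> p < \<sigma> q \<and> \<sigma> q < \<sigma> r} = k"
  shows "(\<Sum>\<sigma>\<in>B. signed_weight x n \<sigma>) = - (x ^ (2 * k)) * (\<Sum>\<sigma>\<in>A. signed_weight x n \<sigma>)"
proof -
  have "(\<Sum>\<sigma>\<in>B. signed_weight x n \<sigma>) = (\<Sum>\<sigma>\<in>A. signed_weight x n (\<sigma> \<circ> transpose p r))"
    using assms(5,6) by (intro sum.reindex_bij_witness[of _ "\<lambda>\<sigma>. \<sigma> \<circ> transpose p r" "\<lambda>\<sigma>. \<sigma> \<circ> transpose p r"])
      (auto simp: comp_assoc)
  also have "\<dots> = (\<Sum>\<sigma>\<in>A. - (x ^ (2 * k)) * signed_weight x n \<sigma>)"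
    by (intro sum.cong refl, subst signed_weight_transpose) (use assms in auto)
  finally show ?thesis by (simp add: sum_distrib_left)
qed

subsection \<open>Local relations between classes\<close>

text \<open>The exchange is a sign-reversing involution: with no entry between the two in both
  position and value, the exponent of \<open>x\<close> is unchanged.\<close>

lemma sum_signed_weight_cancel:
  assumes "finite X" "p < r" "p \<in> {1..n}" "r \<in> {1..n}" "p mod 2 = r mod 2"
    and X: "\<And>\<sigma>. \<sigma> \<in> X \<Longrightarrow> inj \<sigma> \<and> \<sigma> \<circ> transpose p r \<in> X"
    and between: "\<And>\<sigma> q. \<sigma> \<in> X \<Longrightarrow> p < q \<Longrightarrow> q < r \<Longrightarrow>
      \<sigma> q < \<sigma> p \<and> \<sigma> q < \<sigma> r \<or> \<sigma> p < \<sigma> q \<and> \<sigma> r < \<sigma> q"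
  shows "(\<Sum>\<sigma>\<in>X. signed_weight x n \<sigma>) = 0"
proof -
  let ?A = "{\<sigma>\<in>X. \<sigma> p < \<sigma> r}" and ?B = "{\<sigma>\<in>X. \<sigma> r < \<sigma> p}"
  have "\<sigma> p \<noteq> \<sigma> r" if "\<sigma> \<in> X" for \<sigma>
    using X[OF that] assms(2) by (auto dest: injD)
  then have "X = ?A \<union> ?B" by (auto simp: nat_neq_iff)
  then have "(\<Sum>\<sigma>\<in>X. signed_weight x n \<sigma>) = (\<Sum>\<sigma>\<in>?A. signed_weight x n \<sigma>) + (\<Sum>\<sigma>\<in>?B. signed_weight x n \<sigma>)"
    using sum.union_disjoint[of ?A ?B "signed_weight x n"] assms(1) by fastforce
  also have "(\<Sum>\<sigma>\<in>?B. signed_weight x n \<sigma>) = - (x ^ (2 * 0)) * (\<Sum>\<sigma>\<in>?A. signed_weight x n \<sigma>)"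
  proof (rule sum_signed_weight_transpose[OF assms(2-5)])
    fix \<sigma> assume "\<sigma> \<in> ?A"
    then have "{q. p < q \<and> q < r \<and> p mod 2 \<noteq> q mod 2 \<and> \<sigma> p < \<sigma> q \<and> \<sigma> q < \<sigma> r} = {}"
      using between[of \<sigma>] by fastforce
    then show "card {q. p < q \<and> q < r \<and> p mod 2 \<noteq> q mod 2 \<and> \<sigma> p < \<sigma> q \<and> \<sigma> q < \<sigma> r} = 0"
      by simp
  qed (use X in auto)
  finally show ?thesis by simp
qed

text \<open>The middle entry exceeds both neighbours, so exchanging the outer two preserves the peak
  and finds nothing between them in value. A valley is the same upside down.\<close>

lemma class_gf_peak:
  assumes "1 \<le> p" "p + 2 \<le> n" "(I \<union> J) \<inter> {p - 1..p + 2} = {}"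
  shows "class_gf x n (insert p I) (insert (p + 1) J) = 0"
  unfolding class_gf_def
proof (rule sum_signed_weight_cancel[of _ p "p + 2"])
  fix \<sigma> assume \<sigma>: "\<sigma> \<in> ascent_class n (insert p I) (insert (p + 1) J)"
  then have "\<sigma> \<circ> transpose p (p + 2) \<in> ascent_class n I J"
    by (intro ascent_class_transpose[OF _ _ _ assms(1,2,3)]) (auto simp: ascent_class_def)
  with \<sigma> show "inj \<sigma> \<and> \<sigma> \<circ> transpose p (p + 2) \<in> ascent_class n (insert p I) (insert (p + 1) J)"
    using ascent_class_inj by (auto simp: ascent_class_def)
  show "\<sigma> q < \<sigma> p \<and> \<sigma> q < \<sigma> (p + 2) \<or> \<sigma> p < \<sigma> q \<and> \<sigma> (p + 2) < \<sigma> q" if "p < q" "q < p + 2" for q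
  proof -
    have "q = p + 1" using that by simp
    then show ?thesis using \<sigma> by (auto simp: ascent_class_def)
  qed
qed (use assms in auto)

lemma class_gf_valley:
  assumes "1 \<le> p" "p + 2 \<le> n" "(I \<union> J) \<inter> {p - 1..p + 2} = {}"
  shows "class_gf x n (insert (p + 1) I) (insert p J) = 0"
  unfolding class_gf_def
proof (rule sum_signed_weight_cancel[of _ p "p + 2"])
  fix \<sigma> assume \<sigma>: "\<sigma> \<in> ascent_class n (insert (p + 1) I) (insert p J)"
  then have "\<sigma> \<circ> transpose p (p + 2) \<in> ascent_class n I J"
    by (intro ascent_class_transpose[OF _ _ _ assms(1,2,3)]) (auto simp: ascent_class_def)
  with \<sigma> show "inj \<sigma> \<and> \<sigma> \<circ> transpose p (p + 2) \<in> ascent_class n (insert (p + 1) I) (insert p J)"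
    using ascent_class_inj by (auto simp: ascent_class_def)
  show "\<sigma> q < \<sigma> p \<and> \<sigma> q < \<sigma> (p + 2) \<or> \<sigma> p < \<sigma> q \<and> \<sigma> (p + 2) < \<sigma> q" if "p < q" "q < p + 2" for q
  proof -
    have "q = p + 1" using that by simp
    then show ?thesis using \<sigma> by (auto simp: ascent_class_def)
  qed
qed (use assms in auto)

text \<open>Exchanging the outer entries reverses a monotone triple, and the middle entry is the
  single one between them.\<close>

lemma class_gf_reverse_triple:
  assumes "1 \<le> p" "p + 2 \<le> n" "(I \<union> J) \<inter> {p - 1..p + 2} = {}"
  shows "class_gf x n I (insert p (insert (p + 1) J)) = - (x ^ 2) * class_gf x n (insert p (insert (p + 1) I)) J"
proof -
  have *: "\<sigma> \<circ> transpose p (p + 2) \<in> ascent_class n I J" if "\<sigma> \<in> ascent_class n I J" for \<sigma>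
    using that by (rule ascent_class_transpose[OF _ _ _ assms(1,2,3)]) auto
  have "class_gf x n I (insert p (insert (p + 1) J)) = - (x ^ (2 * 1)) * class_gf x n (insert p (insert (p + 1) I)) J"
    unfolding class_gf_def
  proof (rule sum_signed_weight_transpose[of p "p + 2"])
    fix \<sigma> assume \<sigma>: "\<sigma> \<in> ascent_class n (insert p (insert (p + 1) I)) J"
    then have "\<sigma> \<in> ascent_class n I J" by (auto simp: ascent_class_def)
    from *[OF this] \<sigma> show "inj \<sigma> \<and> \<sigma> p < \<sigma> (p + 2) \<and>
        \<sigma> \<circ> transpose p (p + 2) \<in> ascent_class n I (insert p (insert (p + 1) J))"
      using ascent_class_inj[OF \<sigma>] by (auto simp: ascent_class_def)
    have "{q. p < q \<and> q < p + 2 \<and> p mod 2 \<noteq> q mod 2 \<and> \<sigma> p < \<sigma> q \<and> \<sigma> q < \<sigma> (p + 2)} = {p + 1}"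
    proof (intro set_eqI)
      fix q
      have "p < q \<and> q < p + 2 \<longleftrightarrow> q = p + 1" by auto
      moreover have "p mod 2 \<noteq> (p + 1) mod 2" by presburger
      ultimately show "q \<in> {q. p < q \<and> q < p + 2 \<and> p mod 2 \<noteq> q mod 2 \<and> \<sigma> p < \<sigma> q \<and> \<sigma> q < \<sigma> (p + 2)}
          \<longleftrightarrow> q \<in> {p + 1}"
        using \<sigma> by (auto simp: ascent_class_def)
    qed
    then show "card {q. p < q \<and> q < p + 2 \<and> p mod 2 \<noteq> q mod 2 \<and> \<sigma> p < \<sigma> q \<and> \<sigma> q < \<sigma> (p + 2)} = 1"
      by simp
  next
    fix \<sigma> assume \<sigma>: "\<sigma> \<in> ascent_class n I (insert p (insert (p + 1) J))"
    then have "\<sigma> \<in> ascent_class n I J" by (auto simp: ascent_class_def)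
    from *[OF this] \<sigma> show "\<sigma> \<circ> transpose p (p + 2) \<in> ascent_class n (insert p (insert (p + 1) I)) J"
      by (auto simp: ascent_class_def)
  qed (use assms in auto)
  then show ?thesis by simp
qed

text \<open>Split each side at the other of the two indices. The mixed terms are a peak and a valley
  and vanish, so both sides equal the class of the double ascent.\<close>

lemma class_gf_shift_ascent:
  assumes "1 \<le> p" "p + 2 \<le> n" "(I \<union> J) \<inter> {p - 1..p + 2} = {}"
  shows "class_gf x n (insert (p + 1) I) J = class_gf x n (insert p I) J"
  using class_gf_split[of x n "insert p I" J "p + 1"] class_gf_split[of x n "insert (p + 1) I" J p]
    class_gf_peak[OF assms, of x] class_gf_valley[OF assms, of x] by (simp add: insert_commute)

lemma class_gf_shift_descent:
  assumes "1 \<le> p" "p + 2 \<le> n" "(I \<union> J) \<inter> {p - 1..p + 2} = {}"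
  shows "class_gf x n I (insert (p + 1) J) = class_gf x n I (insert p J)"
  using class_gf_split[of x n I "insert p J" "p + 1"] class_gf_split[of x n I "insert (p + 1) J" p]
    class_gf_peak[OF assms, of x] class_gf_valley[OF assms, of x] by (simp add: insert_commute)

text \<open>Up to peaks and valleys a single descent is a double descent and a single ascent a
  double ascent, and these are reverses of each other.\<close>

lemma class_gf_descent_to_ascent:
  assumes "1 \<le> p" "p + 2 \<le> n" "(I \<union> J) \<inter> {p - 1..p + 2} = {}"
  shows "class_gf x n I (insert p J) = - (x ^ 2) * class_gf x n (insert p I) J"
  using class_gf_split[of x n "insert p I" J "p + 1"] class_gf_split[of x n I "insert p J" "p + 1"]
    class_gf_peak[OF assms, of x] class_gf_valley[OF assms, of x] class_gf_reverse_triple[OF assms, of x]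
  by (simp add: insert_commute)

lemma class_gf_free_triple:
  assumes "1 \<le> p" "p + 2 \<le> n" "(I \<union> J) \<inter> {p - 1..p + 2} = {}"
  shows "class_gf x n I J = (1 - x ^ 2) * class_gf x n (insert p I) J"
  using class_gf_split[of x n I J p] class_gf_descent_to_ascent[OF assms, of x] by (simp add: algebra_simps)

section \<open>Merging a pair with an ascending block\<close>

lemma ascending_iff:
  fixes \<sigma> :: "nat \<Rightarrow> nat"
  shows "(\<forall>i\<in>{a..<b}. \<sigma> i < \<sigma> (i + 1)) \<longleftrightarrow> (\<forall>i k. a \<le> i \<longrightarrow> i < k \<longrightarrow> k \<le> b \<longrightarrow> \<sigma> i < \<sigma> k)"
proof
  assume L: "\<forall>i\<in>{a..<b}. \<sigma> i < \<sigma> (i + 1)"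
  have "a \<le> i \<Longrightarrow> i + m < b \<Longrightarrow> \<sigma> i < \<sigma> (i + Suc m)" for i m
  proof (induction m)
    case (Suc m)
    then show ?case using L[rule_format, of "i + Suc m"] by auto
  qed (use L in auto)
  then show "\<forall>i k. a \<le> i \<longrightarrow> i < k \<longrightarrow> k \<le> b \<longrightarrow> \<sigma> i < \<sigma> k"
    by (metis less_imp_Suc_add add_Suc_right less_eq_Suc_le)
qed auto

text \<open>The entries \<open>a\<^sub>0 < a\<^sub>1\<close> of the pair are compared with the entries
  \<open>c\<^sub>0 < \<dots> < c\<^bsub>t-1\<^esub>\<close> of the block. Exchanging \<open>a\<^sub>0\<close> with \<open>c\<^bsub>2j\<^esub>\<close> cancels all arrangements except
  those where both \<open>a\<^sub>0\<close> and \<open>a\<^sub>1\<close> lie between \<open>c\<^bsub>2j-1\<^esub>\<close> and \<open>c\<^bsub>2j\<^esub>\<close> for some \<open>j\<close>; these carry the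
  weight \<open>x\<^bsup>2j\<^esup>\<close> relative to the sorted arrangement.\<close>

lemma class_gf_merge_pair:
  assumes p: "1 \<le> p" "p + 1 + t \<le> n" and free: "(I \<union> J) \<inter> {p - 1..p + 1 + t} = {}"
  shows "class_gf x n (insert p I \<union> {p + 2..p + t}) J =
    (\<Sum>j\<le>t div 2. (x ^ 2) ^ j) * class_gf x n (I \<union> {p..p + t}) J"
proof -
  define C where "C = ascent_class n I J"
  define X where "X = {\<sigma>\<in>C. \<sigma> p < \<sigma> (p + 1) \<and> (\<forall>i k. i < k \<longrightarrow> k < t \<longrightarrow> \<sigma> (p + 2 + i) < \<sigma> (p + 2 + k))}"
  define S where "S = (\<lambda>j. {\<sigma>\<in>X. (\<forall>i<2*j. \<sigma> (p + 2 + i) < \<sigma> p) \<and> (\<forall>i. 2 * j \<le> i \<longrightarrow> i < t \<longrightarrow> \<sigma> (p + 1) < \<sigma> (p + 2 + i))})"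
  \<comment> \<open>\<open>G j\<close> is what remains after levels below \<open>j\<close> are
    removed: \<open>G 0\<close> is everything, and \<open>G j\<close> is the disjoint union of
    \<open>S j\<close>, a cancelling set and \<open>G (j + 1)\<close>. The bound
    \<open>2 * j \<le> t\<close> makes \<open>G\<close> empty beyond \<open>t div 2\<close>.\<close>
  define G where "G = (\<lambda>j. {\<sigma>\<in>X. 2 * j \<le> t \<and> (\<forall>i<2*j. \<sigma> (p + 2 + i) < \<sigma> p)})"
  let ?W = "\<lambda>A. \<Sum>\<sigma>\<in>A. signed_weight x n \<sigma>"
  have fin [simp]: "finite X" "finite (S j)" "finite (G j)" for j
    by (auto simp: X_def C_def S_def G_def)
  have inj: "inj \<sigma>" if "\<sigma> \<in> X" for \<sigma>
    using that by (auto simp: X_def C_def ascent_class_inj)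
  have swap: "\<sigma> \<circ> transpose u v \<in> C" if "\<sigma> \<in> C" "u \<in> {p..p + 1 + t}" "v \<in> {p..p + 1 + t}" for \<sigma> u v
    using that ascent_class_transpose[OF _ _ _ p free] unfolding C_def by blast
  have X_eq: "ascent_class n (insert p I \<union> {p + 2..p + t}) J = X"
  proof (intro set_eqI)
    fix \<sigma> :: "nat \<Rightarrow> nat"
    have "(\<forall>i\<in>{p + 2..p + t}. \<sigma> i < \<sigma> (i + 1)) \<longleftrightarrow> (\<forall>i\<in>{p + 2..<p + t + 1}. \<sigma> i < \<sigma> (i + 1))"
      by auto
    also have "\<dots> \<longleftrightarrow> (\<forall>i k. i < k \<longrightarrow> k < t \<longrightarrow> \<sigma> (p + 2 + i) < \<sigma> (p + 2 + k))"
      unfolding ascending_iff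
    proof (intro iffI allI impI)
      fix i k assume *: "\<forall>i k. i < k \<longrightarrow> k < t \<longrightarrow> \<sigma> (p + 2 + i) < \<sigma> (p + 2 + k)"
        "p + 2 \<le> i" "i < k" "k \<le> p + t + 1"
      then have "p + 2 + (i - (p + 2)) = i" "p + 2 + (k - (p + 2)) = k" by linarith+
      moreover have "i - (p + 2) < k - (p + 2)" "k - (p + 2) < t" using * by linarith+
      ultimately show "\<sigma> i < \<sigma> k" using *(1) by metis
    qed simp
    finally show "\<sigma> \<in> ascent_class n (insert p I \<union> {p + 2..p + t}) J \<longleftrightarrow> \<sigma> \<in> X"
      by (auto simp: X_def C_def ascent_class_def)
  qed
  have S0: "S 0 = ascent_class n (I \<union> {p..p + t}) J"
  proof (intro set_eqI)
    fix \<sigma> :: "nat \<Rightarrow> nat"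
    have "(\<forall>i\<in>{p..p + t}. \<sigma> i < \<sigma> (i + 1)) \<longleftrightarrow> (\<forall>i\<in>{p..<p + t + 1}. \<sigma> i < \<sigma> (i + 1))"
      by auto
    also have "\<dots> \<longleftrightarrow> \<sigma> p < \<sigma> (p + 1) \<and> (\<forall>i k. i < k \<longrightarrow> k < t \<longrightarrow> \<sigma> (p + 2 + i) < \<sigma> (p + 2 + k)) \<and>
       (\<forall>i<t. \<sigma> (p + 1) < \<sigma> (p + 2 + i))" (is "_ \<longleftrightarrow> ?R")
      unfolding ascending_iff
    proof (intro iffI allI impI)
      fix i k assume *: ?R "p \<le> i" "i < k" "k \<le> p + t + 1"
      then consider "i = p" "k = p + 1" | "i = p" "k \<ge> p + 2" | "i = p + 1" "k \<ge> p + 2" | "i \<ge> p + 2" "k \<ge> p + 2"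
        by linarith
      then show "\<sigma> i < \<sigma> k"
      proof cases
        case 1
        then show ?thesis using *(1) by blast
      next
        case 2
        then have "k = p + 2 + (k - (p + 2))" "k - (p + 2) < t" using * by linarith+
        then have "\<sigma> (p + 1) < \<sigma> k" using *(1) by metis
        then show ?thesis using *(1) 2 by (metis less_trans)
      next
        case 3
        then have "k = p + 2 + (k - (p + 2))" "k - (p + 2) < t" using * by linarith+
        then show ?thesis using *(1) 3 by metis
      next
        case 4
        then have "p + 2 + (i - (p + 2)) = i" "p + 2 + (k - (p + 2)) = k"
          "i - (p + 2) < k - (p + 2)" "k - (p + 2) < t" using * by linarith+
        then show ?thesis using *(1) by metis
      qed
    qed auto
    finally show "\<sigma> \<in> S 0 \<longleftrightarrow> \<sigma> \<in> ascent_class n (I \<union> {p..p + t}) J"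
      by (auto simp: S_def X_def C_def ascent_class_def)
  qed
  have G_step: "?W (G j) = ?W (S j) + ?W (G (j + 1))" if j: "2 * j \<le> t" for j
  proof -
    \<comment> \<open>In \<open>N\<close> both \<open>a\<^sub>0\<close> and the block entry of index
      \<open>2 * j\<close> lie between that entry's neighbours in the block and below
      \<open>a\<^sub>1\<close>, so exchanging them stays in \<open>N\<close>. Nothing separates the
      two: the earlier block entries are smaller than both and \<open>a\<^sub>1\<close> is
      larger.\<close>
    define N where "N = {\<sigma>\<in>X. (\<forall>i<2*j. \<sigma> (p + 2 + i) < \<sigma> p) \<and> 2 * j < t \<and> \<sigma> (p + 2 + 2 * j) < \<sigma> (p + 1)
      \<and> (2 * j + 1 < t \<longrightarrow> \<sigma> p < \<sigma> (p + 2 + (2 * j + 1)))}"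
    have "?W N = 0"
    proof (cases "2 * j < t")
      case True
      show ?thesis
      proof (rule sum_signed_weight_cancel[of N p "p + 2 + 2 * j"])
        fix \<sigma> assume \<sigma>: "\<sigma> \<in> N"
        let ?\<tau> = "\<sigma> \<circ> transpose p (p + 2 + 2 * j)"
        have v: "?\<tau> p = \<sigma> (p + 2 + 2 * j)" "?\<tau> (p + 2 + 2 * j) = \<sigma> p" "?\<tau> (p + 1) = \<sigma> (p + 1)"
          "\<And>i. i \<noteq> 2 * j \<Longrightarrow> ?\<tau> (p + 2 + i) = \<sigma> (p + 2 + i)"
          by (auto simp: transpose_def)
        have mon: "\<And>i k. i < k \<Longrightarrow> k < t \<Longrightarrow> \<sigma> (p + 2 + i) < \<sigma> (p + 2 + k)"
          and low: "\<And>i. i < 2 * j \<Longrightarrow> \<sigma> (p + 2 + i) < \<sigma> p"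
          and a: "\<sigma> p < \<sigma> (p + 1)" "\<sigma> (p + 2 + 2 * j) < \<sigma> (p + 1)"
            "2 * j + 1 < t \<Longrightarrow> \<sigma> p < \<sigma> (p + 2 + (2 * j + 1))"
          using \<sigma> unfolding N_def X_def by blast+
        have high: "\<sigma> p < \<sigma> (p + 2 + k)" if "2 * j < k" "k < t" for k
          using a(3) mon[of "2 * j + 1" k] that by (cases "k = 2 * j + 1") auto
        have "?\<tau> \<in> C" using \<sigma> True by (intro swap) (auto simp: N_def X_def)
        moreover have "?\<tau> (p + 2 + i) < ?\<tau> (p + 2 + k)" if "i < k" "k < t" for i k
          using that mon[of i k] high[of k] low[of i] by (cases "i = 2 * j"; cases "k = 2 * j") (simp_all only: v, auto)
        moreover have "?\<tau> (p + 2 + i) < ?\<tau> p" if "i < 2 * j" for i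
          unfolding v(1) v(4)[OF less_imp_neq[OF that]] using that mon True by blast
        moreover have "2 * j + 1 < t \<longrightarrow> ?\<tau> p < ?\<tau> (p + 2 + (2 * j + 1))"
          unfolding v(1) using v(4)[of "2 * j + 1"] mon[of "2 * j" "2 * j + 1"] by linarith
        moreover have "?\<tau> p < ?\<tau> (p + 1)" "?\<tau> (p + 2 + 2 * j) < ?\<tau> (p + 1)"
          using a by (simp_all only: v)
        ultimately have "?\<tau> \<in> N"
          unfolding N_def X_def using True by blast
        then show "inj \<sigma> \<and> ?\<tau> \<in> N" using inj \<sigma> by (auto simp: N_def)
        fix q assume q: "p < q" "q < p + 2 + 2 * j"
        show "\<sigma> q < \<sigma> p \<and> \<sigma> q < \<sigma> (p + 2 + 2 * j) \<or> \<sigma> p < \<sigma> q \<and> \<sigma> (p + 2 + 2 * j) < \<sigma> q"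
        proof (cases "q = p + 1")
          case False
          define i where "i = q - (p + 2)"
          have "q = p + 2 + i" "i < 2 * j" using q False by (auto simp: i_def)
          then show ?thesis using low[of i] mon[of i "2 * j"] True by simp
        qed (use a in auto)
      qed (use p True in \<open>auto simp: N_def\<close>)
    qed (simp add: N_def)
    have "G j = S j \<union> (N \<union> G (j + 1))"
    proof (intro set_eqI iffI)
      fix \<sigma> assume \<sigma>: "\<sigma> \<in> G j"
      then have X: "\<sigma> \<in> X" and low: "\<And>i. i < 2 * j \<Longrightarrow> \<sigma> (p + 2 + i) < \<sigma> p"
        and mon: "\<And>i k. i < k \<Longrightarrow> k < t \<Longrightarrow> \<sigma> (p + 2 + i) < \<sigma> (p + 2 + k)"
        by (auto simp: G_def X_def)
      have ne: "\<sigma> (p + 2 + i) \<noteq> \<sigma> p" "\<sigma> (p + 2 + i) \<noteq> \<sigma> (p + 1)" for i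
        using inj[OF X] by (simp_all add: inj_eq)
      show "\<sigma> \<in> S j \<union> (N \<union> G (j + 1))"
      \<comment> \<open>If the block entry of index \<open>2 * j\<close> is missing or above
        \<open>a\<^sub>1\<close>, level \<open>j\<close> is reached; otherwise the next block entry
        decides between \<open>N\<close> and \<open>G (j + 1)\<close>.\<close>
      proof (cases "2 * j < t \<and> \<sigma> (p + 2 + 2 * j) < \<sigma> (p + 1)")
        case False
        have "\<sigma> (p + 1) < \<sigma> (p + 2 + i)" if "2 * j \<le> i" "i < t" for i
          using False ne(2)[of "2 * j"] mon[of "2 * j" i] that by (cases "i = 2 * j") auto
        then show ?thesis using X low unfolding S_def by blast
      next
        case True
        show ?thesis
        proof (cases "2 * j + 1 < t \<longrightarrow> \<sigma> p < \<sigma> (p + 2 + (2 * j + 1))")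
          case True
          then show ?thesis using \<open>2 * j < t \<and> _\<close> X low unfolding N_def by blast
        next
          case False
          then have l: "2 * j + 1 < t" "\<sigma> (p + 2 + (2 * j + 1)) < \<sigma> p"
            using ne(1)[of "2 * j + 1"] by linarith+
          have "\<sigma> (p + 2 + i) < \<sigma> p" if "i < 2 * (j + 1)" for i
            using that l mon[of i "2 * j + 1"] by (cases "i = 2 * j + 1") auto
          moreover have "2 * (j + 1) \<le> t" using l by simp
          ultimately show ?thesis using X unfolding G_def by blast
        qed
      qed
    next
      fix \<sigma> assume "\<sigma> \<in> S j \<union> (N \<union> G (j + 1))"
      moreover have "2 * j \<le> 2 * (j + 1)" by simp
      ultimately show "\<sigma> \<in> G j" using j unfolding G_def S_def N_def by fastforce
    qed
    moreover have "S j \<inter> (N \<union> G (j + 1)) = {}" 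
    proof -
      have "\<sigma> \<notin> N \<union> G (j + 1)" if "\<sigma> \<in> S j" for \<sigma>
      proof
        assume m: "\<sigma> \<in> N \<union> G (j + 1)"
        then have "2 * j < t" by (auto simp: N_def G_def)
        then have "\<sigma> (p + 1) < \<sigma> (p + 2 + 2 * j)" "\<sigma> p < \<sigma> (p + 1)"
          using that unfolding S_def X_def by blast+
        moreover have "\<sigma> (p + 2 + 2 * j) < \<sigma> (p + 1) \<or> \<sigma> (p + 2 + 2 * j) < \<sigma> p"
        proof -
          have "2 * j < 2 * (j + 1)" by simp
          then show ?thesis using m unfolding N_def G_def by blast
        qed
        ultimately show False by linarith
      qed
      then show ?thesis by blast
    qed
    moreover have "N \<inter> G (j + 1) = {}"
    proof -
      have "\<sigma> \<notin> G (j + 1)" if "\<sigma> \<in> N" for \<sigma>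
      proof
        assume m: "\<sigma> \<in> G (j + 1)"
        then have "2 * (j + 1) \<le> t" and "\<And>i. i < 2 * (j + 1) \<Longrightarrow> \<sigma> (p + 2 + i) < \<sigma> p"
          unfolding G_def by blast+
        from this(1) this(2)[of "2 * j + 1"] have "2 * j + 1 < t" "\<sigma> (p + 2 + (2 * j + 1)) < \<sigma> p"
          by simp_all
        moreover have "2 * j + 1 < t \<longrightarrow> \<sigma> p < \<sigma> (p + 2 + (2 * j + 1))" using that unfolding N_def by blast
        ultimately show False by linarith
      qed
      then show ?thesis by blast
    qed
    moreover have "finite N" by (auto simp: N_def)
    ultimately show ?thesis
      using \<open>?W N = 0\<close> by (simp add: sum.union_disjoint)
  qed
  have S_step: "?W (S (j + 1)) = x ^ 2 * ?W (S j)" if j: "2 * j + 1 < t" for j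
  proof -
    let ?r = "p + 2 + 2 * j" and ?s = "p + 2 + (2 * j + 1)"
    \<comment> \<open>Exchanging the whole pair with the next two block entries raises the level by
      one. In the first exchange only \<open>a\<^sub>1\<close> lies between, which gives
      \<open>- (x ^ 2)\<close>; in the second nothing does, which gives -1.\<close>
    define R where "R = (\<lambda>\<sigma> :: nat \<Rightarrow> nat. \<sigma> \<circ> transpose p ?r \<circ> transpose (p + 1) ?s)"
    have v: "R \<sigma> p = \<sigma> ?r" "R \<sigma> (p + 1) = \<sigma> ?s" "R \<sigma> ?r = \<sigma> p" "R \<sigma> ?s = \<sigma> (p + 1)"
       "\<And>i. i \<noteq> 2 * j \<Longrightarrow> i \<noteq> 2 * j + 1 \<Longrightarrow> R \<sigma> (p + 2 + i) = \<sigma> (p + 2 + i)" for \<sigma>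
      by (auto simp: R_def transpose_def)
    have RR: "R (R \<sigma>) = \<sigma>" for \<sigma>
      by (rule ext) (auto simp: R_def transpose_def)
    have RC: "R \<sigma> \<in> C" if "\<sigma> \<in> C" for \<sigma>
      unfolding R_def using that j by (intro swap) auto
    have wt: "signed_weight x n (R \<sigma>) = x ^ 2 * signed_weight x n \<sigma>" if "\<sigma> \<in> S j" for \<sigma>
    proof -
      have X: "\<sigma> \<in> X" and a: "\<sigma> p < \<sigma> (p + 1)" and low: "\<And>i. i < 2 * j \<Longrightarrow> \<sigma> (p + 2 + i) < \<sigma> p"
        and high: "\<And>i. 2 * j \<le> i \<Longrightarrow> i < t \<Longrightarrow> \<sigma> (p + 1) < \<sigma> (p + 2 + i)"
        using that unfolding S_def X_def by blast+
      let ?\<rho> = "\<sigma> \<circ> transpose p ?r"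
      have inner: "q = p + 1 \<or> (\<exists>i<2*j. q = p + 2 + i)" if "p < q" "q < ?r" for q
        using that by (auto intro!: exI[of _ "q - (p + 2)"])
      have "{q. p < q \<and> q < ?r \<and> p mod 2 \<noteq> q mod 2 \<and> \<sigma> p < \<sigma> q \<and> \<sigma> q < \<sigma> ?r} = {p + 1}"
      proof (intro set_eqI iffI)
        fix q assume q: "q \<in> {q. p < q \<and> q < ?r \<and> p mod 2 \<noteq> q mod 2 \<and> \<sigma> p < \<sigma> q \<and> \<sigma> q < \<sigma> ?r}"
        then show "q \<in> {p + 1}" using inner[of q] low by force
      next
        fix q assume "q \<in> {p + 1}"
        moreover have "p mod 2 \<noteq> (p + 1) mod 2" by presburger
        ultimately show "q \<in> {q. p < q \<and> q < ?r \<and> p mod 2 \<noteq> q mod 2 \<and> \<sigma> p < \<sigma> q \<and> \<sigma> q < \<sigma> ?r}"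
          using a high[of "2 * j"] j by simp
      qed
      then have 1: "signed_weight x n ?\<rho> = - (x ^ 2) * signed_weight x n \<sigma>"
        using signed_weight_transpose[of p ?r n \<sigma> x] p j a high[of "2 * j"] inj[OF X]
        by simp
      have \<rho>: "?\<rho> (p + 1) = \<sigma> (p + 1)" "?\<rho> ?s = \<sigma> ?s" "?\<rho> ?r = \<sigma> p"
        "\<And>i. i < 2 * j \<Longrightarrow> ?\<rho> (p + 2 + i) = \<sigma> (p + 2 + i)"
        by (auto simp: transpose_def)
      have none: "{q. p + 1 < q \<and> q < ?s \<and> (p + 1) mod 2 \<noteq> q mod 2 \<and> ?\<rho> (p + 1) < ?\<rho> q \<and> ?\<rho> q < ?\<rho> ?s} = {}"
      proof -
        have "?\<rho> q < ?\<rho> (p + 1)" if q: "p + 1 < q" "q < ?s" for q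
        proof (cases "q = ?r")
          case True
          then show ?thesis using a by (simp only: \<rho>)
        next
          case False
          with q obtain i where "i < 2 * j" "q = p + 2 + i" using inner[of q] by auto
          then show ?thesis using low[of i] a \<rho>(1) \<rho>(4)[of i] by (metis less_trans)
        qed
        then show ?thesis by fastforce
      qed
      have "signed_weight x n (R \<sigma>) = - (x ^ (2 * 0)) * signed_weight x n ?\<rho>"
        \<comment> \<open>The exponent 0 is rewritten as the cardinality of the empty set in
          \<open>none\<close>, the form in which \<open>signed_weight_transpose\<close> states
          it.\<close>
        unfolding R_def card.empty[symmetric, where 'a = nat] none[symmetric]
      proof (rule signed_weight_transpose)
        show "inj ?\<rho>" using inj[OF X] by (simp add: inj_compose)
        show "?\<rho> (p + 1) < ?\<rho> ?s" using high[of "2 * j + 1"] j \<rho>(1,2) by linarith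
        show "(p + 1) mod 2 = ?s mod 2" by presburger
      qed (use p j in auto)
      with 1 show ?thesis by simp
    qed
    \<comment> \<open>\<open>P\<close> expresses membership in \<open>S\<close> through the values
      alone. On these \<open>R\<close> is a function update, so \<open>down\<close> and
      \<open>up\<close> can be proved without permutations.\<close>
    define P where "P = (\<lambda>j a b (c :: nat \<Rightarrow> nat). a < b \<and> (\<forall>i k. i < k \<longrightarrow> k < t \<longrightarrow> c i < c k) \<and>
      (\<forall>i<2*j. c i < a) \<and> (\<forall>i. 2 * j \<le> i \<longrightarrow> i < t \<longrightarrow> b < c i))"
    have S_iff: "\<sigma> \<in> S k \<longleftrightarrow> \<sigma> \<in> C \<and> P k (\<sigma> p) (\<sigma> (p + 1)) (\<lambda>i. \<sigma> (p + 2 + i))" for \<sigma> k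
      unfolding S_def X_def P_def by blast
    have R_c: "(\<lambda>i. R \<sigma> (p + 2 + i)) = (\<lambda>i. \<sigma> (p + 2 + i))(2 * j := \<sigma> p, 2 * j + 1 := \<sigma> (p + 1))" for \<sigma>
      by (rule ext) (auto simp: R_def transpose_def)
    have mono_upd: "(c(2 * j := a, 2 * j + 1 := b)) i < (c(2 * j := a, 2 * j + 1 := b)) k"
      if "i < k" "k < t" "a < b" "c i < c k" "i < 2 * j \<Longrightarrow> c i < a" "2 * j + 1 < k \<Longrightarrow> b < c k"
      for c :: "nat \<Rightarrow> nat" and a b i k
      using that by auto
    have down: "P j (c (2 * j)) (c (2 * j + 1)) (c(2 * j := a, 2 * j + 1 := b))"
      if "P (j + 1) a b c" for a b c
    proof -
      have mon: "\<And>i k. i < k \<Longrightarrow> k < t \<Longrightarrow> c i < c k" and "a < b"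
        and low: "\<And>i. i < 2 * (j + 1) \<Longrightarrow> c i < a"
        and high: "\<And>i. 2 * (j + 1) \<le> i \<Longrightarrow> i < t \<Longrightarrow> b < c i"
        using that unfolding P_def by blast+
      show ?thesis
        unfolding P_def
      proof (intro conjI allI impI)
        show "c (2 * j) < c (2 * j + 1)" using mon j by simp
      next
        show "(c(2 * j := a, 2 * j + 1 := b)) i < (c(2 * j := a, 2 * j + 1 := b)) k" if "i < k" "k < t" for i k
          using that \<open>a < b\<close> mon low high by (intro mono_upd) auto
      next
        show "c (2 * j + 1) < (c(2 * j := a, 2 * j + 1 := b)) i" if "2 * j \<le> i" "i < t" for i
          using that \<open>a < b\<close> low[of "2 * j + 1"] mon[of "2 * j + 1" i] by auto
      next
        show "(c(2 * j := a, 2 * j + 1 := b)) i < c (2 * j)" if "i < 2 * j" for i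
          using that mon[of i "2 * j"] j by auto
      qed
    qed
    have up: "P (j + 1) (c (2 * j)) (c (2 * j + 1)) (c(2 * j := a, 2 * j + 1 := b))"
      if "P j a b c" for a b c
    proof -
      have mon: "\<And>i k. i < k \<Longrightarrow> k < t \<Longrightarrow> c i < c k" and "a < b"
        and low: "\<And>i. i < 2 * j \<Longrightarrow> c i < a"
        and high: "\<And>i. 2 * j \<le> i \<Longrightarrow> i < t \<Longrightarrow> b < c i"
        using that unfolding P_def by blast+
      show ?thesis
        unfolding P_def
      proof (intro conjI allI impI)
        show "c (2 * j) < c (2 * j + 1)" using mon j by simp
      next
        show "(c(2 * j := a, 2 * j + 1 := b)) i < (c(2 * j := a, 2 * j + 1 := b)) k" if "i < k" "k < t" for i k
          using that \<open>a < b\<close> mon low high by (intro mono_upd) auto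
      next
        show "c (2 * j + 1) < (c(2 * j := a, 2 * j + 1 := b)) i" if "2 * (j + 1) \<le> i" "i < t" for i
          using that mon[of "2 * j + 1" i] by auto
      next
        show "(c(2 * j := a, 2 * j + 1 := b)) i < c (2 * j)" if "i < 2 * (j + 1)" for i
          using that \<open>a < b\<close> high[of "2 * j"] mon[of i "2 * j"] j by auto
      qed
    qed
    have "?W (S (j + 1)) = (\<Sum>\<sigma>\<in>S j. signed_weight x n (R \<sigma>))"
    proof (rule sum.reindex_bij_witness[of _ R R])
      show "R \<sigma> \<in> S j" if "\<sigma> \<in> S (j + 1)" for \<sigma>
        using that down RC unfolding S_iff R_c v by blast
      show "R \<sigma> \<in> S (j + 1)" if "\<sigma> \<in> S j" for \<sigma>
        using that up RC unfolding S_iff R_c v by blast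
    qed (auto simp: RR)
    then show ?thesis by (simp add: wt sum_distrib_left)
  qed
  have S: "?W (S j) = (x ^ 2) ^ j * ?W (S 0)" if "j \<le> t div 2" for j
    using that
  proof (induction j)
    case (Suc j)
    then show ?case using S_step[of j] by (simp add: mult.assoc)
  qed simp
  \<comment> \<open>Counting down from \<open>t div 2 + 1\<close>, where \<open>G\<close> is empty,
    telescopes \<open>G_step\<close>.\<close>
  have "?W (G (t div 2 + 1 - k)) = (\<Sum>j\<in>{t div 2 + 1 - k..t div 2}. ?W (S j))" if "k \<le> t div 2 + 1" for k
    using that
  proof (induction k)
    case 0
    have "G (t div 2 + 1) = {}" by (auto simp: G_def)
    then show ?case by simp
  next
    case (Suc k)
    define j where "j = t div 2 + 1 - Suc k"
    have j: "t div 2 + 1 - k = j + 1" "j \<le> t div 2" using Suc.prems by (auto simp: j_def)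
    then have "2 * j \<le> t" by linarith
    from G_step[OF this] Suc j show ?case
      unfolding j_def[symmetric] by (simp add: sum.atLeast_Suc_atMost)
  qed
  from this[of "t div 2 + 1"] have "?W (G 0) = (\<Sum>j\<le>t div 2. ?W (S j))"
    by (simp add: atMost_atLeast0)
  also have "\<dots> = (\<Sum>j\<le>t div 2. (x ^ 2) ^ j * ?W (S 0))"
    by (intro sum.cong refl S) auto
  also have "G 0 = X" by (auto simp: G_def)
  finally show ?thesis
    unfolding class_gf_def X_eq S0[symmetric] sum_distrib_right .
qed

subsection \<open>Decomposing blocks into pairs\<close>

lemma q_int_eq_sum: "q \<noteq> 1 \<Longrightarrow> q_int q m = (\<Sum>j<m. q ^ j)"
  by (simp add: q_int_def sum_gp_strict)

lemma q_fact_Suc: "q_fact q (Suc m) = q_int q (Suc m) * q_fact q m"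
  by (simp add: q_fact_def)

lemma q_fact_0 [simp]: "q_fact q 0 = 1"
  by (simp add: q_fact_def)

text \<open>The q-integer \<open>[k]\<close> at \<open>1/q\<close> is \<open>[k]\<close> at
  \<open>q\<close> divided by \<open>q ^ (k - 1)\<close>. With \<open>q = x\<^sup>2\<close> the
  exponents of \<open>x\<close> sum to \<open>m * (m - 1)\<close>.\<close>

lemma q_fact_inverse:
  assumes "x \<noteq> 0" "x ^ 2 \<noteq> 1"
  shows "x ^ (m * (m - 1)) * q_fact (inverse x ^ 2) m = q_fact (x ^ 2) m"
proof (induction m)
  case (Suc m)
  have "inverse x ^ 2 \<noteq> 1"
    using assms by (simp add: power_inverse)
  then have "x ^ (2 * m) * q_int (inverse x ^ 2) (Suc m) = (\<Sum>j<Suc m. x ^ (2 * m) * (inverse x ^ 2) ^ j)"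
    by (simp add: q_int_eq_sum sum_distrib_left del: sum.lessThan_Suc)
  also have "\<dots> = (\<Sum>j<Suc m. (x ^ 2) ^ (Suc m - Suc j))"
  proof (intro sum.cong refl)
    fix j assume "j \<in> {..<Suc m}"
    then have "x ^ (2 * m) = (x ^ 2) ^ (Suc m - Suc j) * (x ^ 2) ^ j"
      by (simp add: power_mult flip: power_add)
    then show "x ^ (2 * m) * (inverse x ^ 2) ^ j = (x ^ 2) ^ (Suc m - Suc j)"
      using assms(1) by (simp add: power_inverse)
  qed
  also have "\<dots> = q_int (x ^ 2) (Suc m)"
    using assms(2) by (subst sum.nat_diff_reindex) (simp add: q_int_eq_sum)
  finally have "x ^ (2 * m) * q_int (inverse x ^ 2) (Suc m) = q_int (x ^ 2) (Suc m)" .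
  moreover have "Suc m * (Suc m - 1) = 2 * m + m * (m - 1)"
    by (cases m) simp_all
  ultimately show ?case
    using Suc.IH by (simp only: q_fact_Suc power_add ac_simps) (metis mult.assoc mult.left_commute)
qed simp

text \<open>The first indices of the disjoint pairs cut from the left of the block of positions
  \<open>a..b\<close>; a block of odd length leaves its last position single. The half-open range
  matches the ascent set \<open>{a..<b}\<close> of that block.\<close>

definition alternate :: "nat \<Rightarrow> nat \<Rightarrow> nat set" where
  "alternate a b = {i \<in> {a..<b}. even (i - a)}"

lemma alternate_subset: "alternate a b \<subseteq> {a..<b}"
  by (auto simp: alternate_def)

lemma alternate_rec: "a < b \<Longrightarrow> alternate a b = insert a (alternate (a + 2) b)"
proof (intro set_eqI iffI)
  fix i assume "a < b" "i \<in> alternate a b"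
  then have "i = a \<or> a + 2 \<le> i \<and> i < b \<and> even (i - a)" unfolding alternate_def
    by (cases "i = a + 1") auto
  moreover have "even (i - a) \<longleftrightarrow> even (i - (a + 2))" if "a + 2 \<le> i"
    using that by (auto simp: le_iff_add)
  ultimately show "i \<in> insert a (alternate (a + 2) b)"
    by (auto simp: alternate_def)
qed (auto simp: alternate_def)

lemma card_alternate: "card (alternate a b) = (b - a + 1) div 2"
proof (induction "b - a" arbitrary: a rule: less_induct)
  case less
  show ?case
  proof (cases "a < b")
    case True
    have "finite (alternate (a + 2) b)" "a \<notin> alternate (a + 2) b"
      by (auto simp: alternate_def)
    moreover have "(b - a + 1) div 2 = Suc ((b - (a + 2) + 1) div 2)" if "a + 2 \<le> b"
      using that by (auto simp: le_iff_add)
    moreover have "alternate (a + 2) b = {}" "b - a = 1" if "\<not> a + 2 \<le> b"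
      using that True by (auto simp: alternate_def)
    ultimately show ?thesis using less[of "a + 2"] True by (cases "a + 2 \<le> b") (auto simp: alternate_rec)
  qed (simp add: alternate_def)
qed

text \<open>By induction the pairs to the right of the first one merge into a block of
  \<open>t\<close> positions, and \<open>class_gf_merge_pair\<close> attaches the first pair to it.
  The successive q-integers multiply to a q-factorial.\<close>

lemma class_gf_alternate:
  assumes "x ^ 2 \<noteq> 1" "1 \<le> a" "b \<le> n" "(I \<union> J) \<inter> {a - 1..b} = {}"
  shows "class_gf x n (I \<union> alternate a b) J = q_fact (x ^ 2) ((b - a + 1) div 2) * class_gf x n (I \<union> {a..<b}) J"
  using assms(2-4)
proof (induction "b - a" arbitrary: a I rule: less_induct)
  case less
  show ?case
  proof (cases "a < b")
    case True
    define t where "t = b - a - 1"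
    have b: "b = a + t + 1" using True by (simp add: t_def)
    have "class_gf x n (I \<union> alternate a b) J = class_gf x n (insert a I \<union> alternate (a + 2) b) J"
      using True by (simp add: alternate_rec)
    also have "\<dots> = q_fact (x ^ 2) (t div 2) * class_gf x n (insert a I \<union> {a + 2..<b}) J"
    proof (cases "t = 0")
      case False
      have "(b - (a + 2) + 1) div 2 = t div 2" using False b by simp
      moreover have "(insert a I \<union> J) \<inter> {a + 2 - 1..b} = {}"
      proof -
        have "{a + 2 - 1..b} \<subseteq> {a - 1..b}" by auto
        then show ?thesis using less.prems(3) by fastforce
      qed
      ultimately show ?thesis using less.hyps[of "a + 2" "insert a I"] less.prems True by simp
    qed (simp add: b alternate_def)
    also have "{a + 2..<b} = {a + 2..a + t}" using b by auto
    also have "class_gf x n (insert a I \<union> {a + 2..a + t}) J =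
        (\<Sum>j\<le>t div 2. (x ^ 2) ^ j) * class_gf x n (I \<union> {a..a + t}) J"
      using less.prems b by (intro class_gf_merge_pair) auto
    also have "{a..a + t} = {a..<b}" using b by auto
    also have "(\<Sum>j\<le>t div 2. (x ^ 2) ^ j) = q_int (x ^ 2) (Suc (t div 2))"
      using assms(1) by (simp add: q_int_eq_sum lessThan_Suc_atMost)
    finally show ?thesis by (simp add: b q_fact_Suc)
  qed (simp add: alternate_def)
qed

section \<open>Complementation of the values\<close>

definition complement_perm :: "nat \<Rightarrow> (nat \<Rightarrow> nat) \<Rightarrow> nat \<Rightarrow> nat" where
  "complement_perm n \<sigma> i = (if i \<in> {1..n} then n + 1 - \<sigma> i else i)"

text \<open>Each pair of positions is inverted in exactly one of the two permutations. The
  decreasing function \<open>n - i\<close> is only a device for counting all pairs allowed by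
  \<open>Q\<close>.\<close>

lemma inversions_on_complement:
  assumes "\<sigma> permutes {1..n}"
  shows "inversions_on Q n \<sigma> + inversions_on Q n (complement_perm n \<sigma>) = inversions_on Q n (\<lambda>i. n - i)"
proof -
  have "of_bool (i < j \<and> \<sigma> j < \<sigma> i \<and> Q i j) +
      of_bool (i < j \<and> complement_perm n \<sigma> j < complement_perm n \<sigma> i \<and> Q i j) =
      (of_bool (i < j \<and> n - j < n - i \<and> Q i j) :: nat)" if "i \<in> {1..n}" "j \<in> {1..n}" for i j
  proof -
    have "\<sigma> i \<in> {1..n}" "\<sigma> j \<in> {1..n}" using that permutes_in_image[OF assms] by blast+
    moreover have "\<sigma> i = \<sigma> j \<longleftrightarrow> i = j" using permutes_inj[OF assms] by (simp add: inj_eq)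
    ultimately show ?thesis using that by (auto simp: complement_perm_def)
  qed
  then show ?thesis
    unfolding inversions_on_def sum.distrib[symmetric] by (intro sum.cong refl)
qed

text \<open>The prefactor is the weight with every pair inverted. It is never evaluated:
  \<open>class_gf_unmixed\<close> complements twice, and it drops out.\<close>

lemma class_gf_complement:
  assumes "x \<noteq> 0" "I \<subseteq> {1..<n}" "J \<subseteq> {1..<n}"
  shows "class_gf x n I J = signed_weight x n (\<lambda>i. n - i) * class_gf (inverse x) n J I"
proof -
  have involutive: "complement_perm n (complement_perm n \<sigma>) = \<sigma>" if "\<sigma> permutes {1..n}" for \<sigma>
  proof
    fix i
    show "complement_perm n (complement_perm n \<sigma>) i = \<sigma> i"
      using permutes_in_image[OF that, of i] permutes_not_in[OF that, of i] by (auto simp: complement_perm_def)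
  qed
  have mem: "complement_perm n \<sigma> \<in> ascent_class n I J"
    if \<sigma>: "\<sigma> \<in> ascent_class n J I" and "I \<subseteq> {1..<n}" "J \<subseteq> {1..<n}" for \<sigma> I J
  proof -
    have p: "\<sigma> permutes {1..n}" using \<sigma> by (rule ascent_class_perm)
    have r: "1 \<le> \<sigma> i" "\<sigma> i \<le> n" if "i \<in> {1..n}" for i using permutes_in_image[OF p, of i] that by auto
    have "inj_on (complement_perm n \<sigma>) {1..n}"
    proof (rule inj_onI)
      fix i j assume *: "i \<in> {1..n}" "j \<in> {1..n}" "complement_perm n \<sigma> i = complement_perm n \<sigma> j"
      then have "\<sigma> i = \<sigma> j" using r[of i] r[of j] by (auto simp: complement_perm_def)
      then show "i = j" using permutes_inj[OF p] by (simp add: inj_eq)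
    qed
    moreover have "complement_perm n \<sigma> ` {1..n} \<subseteq> {1..n}"
    proof
      fix k assume "k \<in> complement_perm n \<sigma> ` {1..n}"
      then obtain i where "i \<in> {1..n}" "k = n + 1 - \<sigma> i" by (auto simp: complement_perm_def)
      then show "k \<in> {1..n}" using r[of i] by (auto intro: diff_le_mono)
    qed
    ultimately have "bij_betw (complement_perm n \<sigma>) {1..n} {1..n}"
      by (simp add: bij_betw_def endo_inj_surj)
    then have "complement_perm n \<sigma> permutes {1..n}"
      by (rule bij_imp_permutes) (auto simp: complement_perm_def)
    moreover have "complement_perm n \<sigma> i < complement_perm n \<sigma> (i + 1)" if "i \<in> I" for i
    proof -
      have "i \<in> {1..<n}" "\<sigma> (i + 1) < \<sigma> i" using that \<sigma> \<open>I \<subseteq> {1..<n}\<close> by (auto simp: ascent_class_def)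
      then show ?thesis using r[of i] r[of "i + 1"] by (auto simp: complement_perm_def)
    qed
    moreover have "complement_perm n \<sigma> (i + 1) < complement_perm n \<sigma> i" if "i \<in> J" for i
    proof -
      have "i \<in> {1..<n}" "\<sigma> i < \<sigma> (i + 1)" using that \<sigma> \<open>J \<subseteq> {1..<n}\<close> by (auto simp: ascent_class_def)
      then show ?thesis using r[of i] r[of "i + 1"] by (auto simp: complement_perm_def)
    qed
    ultimately show ?thesis by (simp add: ascent_class_def)
  qed
  have "signed_weight x n (\<lambda>i. n - i) * signed_weight (inverse x) n (complement_perm n \<sigma>) = signed_weight x n \<sigma>"
    if "\<sigma> \<in> ascent_class n I J" for \<sigma>
  proof -
    note inversions_on_complement[OF ascent_class_perm[OF that], symmetric]
    then have eq: "inv_length n (\<lambda>i. n - i) = inv_length n \<sigma> + inv_length n (complement_perm n \<sigma>)"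
      "odd_length n (\<lambda>i. n - i) = odd_length n \<sigma> + odd_length n (complement_perm n \<sigma>)"
      unfolding inv_length_eq odd_length_eq by blast+
    have 1: "x ^ k * inverse x ^ k = 1" for k
      using assms(1) by (simp flip: power_mult_distrib)
    have 2: "(- 1 :: 'a) ^ k * (- 1) ^ k = 1" for k
      by (simp flip: power_mult_distrib)
    have "signed_weight x n (\<lambda>i. n - i) * signed_weight (inverse x) n (complement_perm n \<sigma>) =
        signed_weight x n \<sigma> * ((- 1) ^ inv_length n (complement_perm n \<sigma>) * (- 1) ^ inv_length n (complement_perm n \<sigma>)) *
        (x ^ odd_length n (complement_perm n \<sigma>) * inverse x ^ odd_length n (complement_perm n \<sigma>))"
      unfolding signed_weight_def eq power_add by (simp only: ac_simps)
    then show ?thesis by (simp only: 1 2 mult_1_right)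
  qed
  then have "class_gf x n I J =
      (\<Sum>\<sigma>\<in>ascent_class n I J. signed_weight x n (\<lambda>i. n - i) * signed_weight (inverse x) n (complement_perm n \<sigma>))"
    by (simp add: class_gf_def)
  also have "\<dots> = (\<Sum>\<sigma>\<in>ascent_class n J I. signed_weight x n (\<lambda>i. n - i) * signed_weight (inverse x) n \<sigma>)"
  proof (rule sum.reindex_bij_witness[of _ "complement_perm n" "complement_perm n"])
    show "complement_perm n (complement_perm n \<sigma>) = \<sigma>" if "\<sigma> \<in> ascent_class n I J" for \<sigma>
      using involutive ascent_class_perm that by blast
    show "complement_perm n (complement_perm n \<sigma>) = \<sigma>" if "\<sigma> \<in> ascent_class n J I" for \<sigma>
      using involutive ascent_class_perm that by blast
  qed (use mem assms in auto)
  finally show ?thesis by (simp add: class_gf_def sum_distrib_left)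
qed

subsection \<open>Classes with almost all ascents\<close>

lemma ascending_gap:
  fixes \<sigma> :: "nat \<Rightarrow> nat"
  assumes "\<And>i. i \<in> {a..<b} \<Longrightarrow> \<sigma> i < \<sigma> (i + 1)" "a \<le> i" "i + m \<le> b"
  shows "\<sigma> i + m \<le> \<sigma> (i + m)"
  using assms(3)
proof (induction m)
  case (Suc m)
  then show ?case using assms(1)[of "i + m"] assms(2) by fastforce
qed simp

lemma class_gf_all_ascents: "class_gf x n {1..<n} {} = 1"
proof -
  have "ascent_class n {1..<n} {} = {id}"
  proof (intro set_eqI iffI)
    fix \<sigma> assume "\<sigma> \<in> ascent_class n {1..<n} {}"
    then have p: "\<sigma> permutes {1..n}" and asc: "\<And>i. i \<in> {1..<n} \<Longrightarrow> \<sigma> i < \<sigma> (i + 1)"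
      unfolding ascent_class_def by blast+
    have "i \<le> \<sigma> i" if "i \<in> {1..n}" for i
    proof -
      have "\<sigma> 1 \<in> {1..n}" using permutes_in_image[OF p, of 1] that by auto
      then show ?thesis using ascending_gap[of 1 n \<sigma> 1 "i - 1", OF asc] that by auto
    qed
    then show "\<sigma> \<in> {id}" using permutes_natset_ge[OF p] by blast
  qed (auto simp: ascent_class_def permutes_id)
  moreover have "inversions_on Q n id = 0" for Q
    unfolding inversions_on_def by (intro sum.neutral ballI) auto
  ultimately show ?thesis
    by (simp add: class_gf_def signed_weight_def inv_length_eq odd_length_eq)
qed

text \<open>The entry 1 at the even position \<open>n\<close> is inverted with all
  \<open>n - 1\<close> others, an odd number, of which the \<open>m\<close> odd positions count for
  \<open>odd_length\<close>.\<close>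

lemma signed_weight_rotation:
  assumes "n = 2 * m" "1 \<le> m" "\<sigma> n = 1" "\<And>i. i \<in> {1..<n} \<Longrightarrow> \<sigma> i = i + 1"
  shows "signed_weight x n \<sigma> = - (x ^ m)"
proof -
  have inv: "i \<in> {1..n} \<and> j \<in> {1..n} \<and> i < j \<and> \<sigma> j < \<sigma> i \<longleftrightarrow> i \<in> {1..<n} \<and> j = n" for i j
    using assms(3) assms(4)[of i] assms(4)[of j] by (cases "j = n") auto
  have "{(i, j). i \<in> {1..n} \<and> j \<in> {1..n} \<and> i < j \<and> \<sigma> i > \<sigma> j} = (\<lambda>i. (i, n)) ` {1..<n}"
    using inv by auto
  then have "inv_length n \<sigma> = n - 1"
    unfolding inv_length_def by (simp add: card_image inj_on_def)
  moreover have "{(i, j). i \<in> {1..n} \<and> j \<in> {1..n} \<and> i < j \<and> \<sigma> i > \<sigma> j \<and> i mod 2 \<noteq> j mod 2}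
      = (\<lambda>i. (2 * i + 1, n)) ` {..<m}"
  proof (intro set_eqI iffI)
    fix z assume "z \<in> {(i, j). i \<in> {1..n} \<and> j \<in> {1..n} \<and> i < j \<and> \<sigma> i > \<sigma> j \<and> i mod 2 \<noteq> j mod 2}"
    then obtain i j where "z = (i, j)" "i \<in> {1..n} \<and> j \<in> {1..n} \<and> i < j \<and> \<sigma> j < \<sigma> i" "i mod 2 \<noteq> j mod 2"
      by auto
    with inv[of i j] have z: "z = (i, n)" "i \<in> {1..<n}" "i mod 2 \<noteq> n mod 2" by simp_all
    then have "odd i" using assms(1) by auto
    then obtain k where "i = 2 * k + 1" by (rule oddE)
    then show "z \<in> (\<lambda>i. (2 * i + 1, n)) ` {..<m}" using z assms(1) by auto
  next
    fix z assume "z \<in> (\<lambda>i. (2 * i + 1, n)) ` {..<m}"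
    then obtain i where i: "z = (2 * i + 1, n)" "i < m" by auto
    then have "2 * i + 1 \<in> {1..<n}" "(2 * i + 1) mod 2 \<noteq> n mod 2" using assms(1) by auto
    then show "z \<in> {(i, j). i \<in> {1..n} \<and> j \<in> {1..n} \<and> i < j \<and> \<sigma> i > \<sigma> j \<and> i mod 2 \<noteq> j mod 2}"
      using inv[of "2 * i + 1" n] i(1) by auto
  qed
  then have "odd_length n \<sigma> = m"
    unfolding odd_length_def by (simp add: card_image inj_on_def)
  moreover have "odd (n - 1)" using assms(1,2) by simp
  ultimately show ?thesis by (simp add: signed_weight_def)
qed

text \<open>Such a permutation is determined by its last entry. Exchanging the last position with an
  even position \<open>2 * j\<close> cancels those whose last entry lies between the entries at
  \<open>2 * j - 1\<close> and \<open>2 * j + 1\<close>. Left over are the identity, of weight 1,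
  and the rotation with last entry 1.\<close>

lemma class_gf_all_but_last:
  assumes n: "n = 2 * m" "1 \<le> m"
  shows "class_gf x n {1..<n - 1} {} = 1 - x ^ m"
proof -
  define C where "C = ascent_class n {1..<n - 1} {}"
  let ?W = "\<lambda>A. \<Sum>\<sigma>\<in>A. signed_weight x n \<sigma>"
  \<comment> \<open>The sets \<open>U j\<close> shrink by a cancelling set at each step, from
    everything but the rotation at \<open>U 1\<close> to the identity alone at
    \<open>U m\<close>.\<close>
  define U where "U = (\<lambda>j. {\<sigma>\<in>C. \<sigma> (2 * j - 1) < \<sigma> n})"
  have C_iff: "\<sigma> \<in> C \<longleftrightarrow> \<sigma> permutes {1..n} \<and> (\<forall>i k. 1 \<le> i \<longrightarrow> i < k \<longrightarrow> k \<le> n - 1 \<longrightarrow> \<sigma> i < \<sigma> k)" for \<sigma>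
    using ascending_iff[of 1 "n - 1" \<sigma>] by (simp add: C_def ascent_class_def)
  have [simp]: "finite C" by (simp add: C_def)
  have inj: "inj \<sigma>" if "\<sigma> \<in> C" for \<sigma> using that ascent_class_inj C_def by blast
  have step: "?W (U j) = ?W (U (j + 1))" if j: "1 \<le> j" "j < m" for j
  proof -
    define N where "N = {\<sigma>\<in>C. \<sigma> (2 * j - 1) < \<sigma> n \<and> \<sigma> n < \<sigma> (2 * j + 1)}"
    have "?W N = 0"
    proof (rule sum_signed_weight_cancel[of N "2 * j" n])
      fix \<sigma> assume \<sigma>: "\<sigma> \<in> N"
      let ?\<tau> = "\<sigma> \<circ> transpose (2 * j) n"
      have mon: "\<And>i k. 1 \<le> i \<Longrightarrow> i < k \<Longrightarrow> k \<le> n - 1 \<Longrightarrow> \<sigma> i < \<sigma> k"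
        and p: "\<sigma> permutes {1..n}" and b: "\<sigma> (2 * j - 1) < \<sigma> n" "\<sigma> n < \<sigma> (2 * j + 1)"
        using \<sigma> C_iff[of \<sigma>] unfolding N_def by blast+
      have v: "?\<tau> (2 * j) = \<sigma> n" "?\<tau> n = \<sigma> (2 * j)" "\<And>i. i \<noteq> 2 * j \<Longrightarrow> i \<noteq> n \<Longrightarrow> ?\<tau> i = \<sigma> i"
        by (auto simp: transpose_def)
      have low: "\<sigma> i < \<sigma> n" if "1 \<le> i" "i < 2 * j" for i
      proof (cases "i = 2 * j - 1")
        case False
        then have "i < 2 * j - 1" "2 * j - 1 \<le> n - 1" using that j n by linarith+
        then show ?thesis using mon[OF that(1)] b(1) less_trans by blast
      qed (use b in simp)
      have high: "\<sigma> n < \<sigma> k" if "2 * j < k" "k \<le> n - 1" for k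
      proof (cases "k = 2 * j + 1")
        case False
        then have "1 \<le> 2 * j + 1" "2 * j + 1 < k" using that by linarith+
        then show ?thesis using mon that(2) b(2) less_trans by blast
      qed (use b in simp)
      have "?\<tau> permutes {1..n}"
        using j n p by (intro permutes_compose permutes_swap_id) auto
      moreover have "?\<tau> i < ?\<tau> k" if "1 \<le> i" "i < k" "k \<le> n - 1" for i k
      proof -
        have "i \<noteq> n" "k \<noteq> n" using that by auto
        then show ?thesis using that low[of i] high[of k] mon[of i k] v(1) v(3)[of i] v(3)[of k]
          by (cases "i = 2 * j"; cases "k = 2 * j") (auto simp del: o_apply)
      qed
      moreover have "?\<tau> (2 * j - 1) < ?\<tau> n" "?\<tau> n < ?\<tau> (2 * j + 1)"
        using v(2) v(3)[of "2 * j - 1"] v(3)[of "2 * j + 1"] mon[of "2 * j - 1" "2 * j"] mon[of "2 * j" "2 * j + 1"] j n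
        by (simp_all del: o_apply)
      ultimately have "?\<tau> \<in> N" unfolding N_def C_iff by blast
      moreover have "inj \<sigma>" using \<sigma> inj by (simp add: N_def)
      ultimately show "inj \<sigma> \<and> ?\<tau> \<in> N" by blast
      fix q assume q: "2 * j < q" "q < n"
      then show "\<sigma> q < \<sigma> (2 * j) \<and> \<sigma> q < \<sigma> n \<or> \<sigma> (2 * j) < \<sigma> q \<and> \<sigma> n < \<sigma> q"
        using high[of q] mon[of "2 * j" q] j by auto
    qed (use j n in \<open>auto simp: N_def\<close>)
    have "U j = N \<union> U (j + 1)"
    proof (intro set_eqI iffI)
      fix \<sigma> assume \<sigma>: "\<sigma> \<in> U j"
      then have "\<sigma> n \<noteq> \<sigma> (2 * j + 1)" using inj[of \<sigma>] j n by (auto simp: U_def inj_eq)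
      then show "\<sigma> \<in> N \<union> U (j + 1)" using \<sigma> by (auto simp: U_def N_def)
    next
      fix \<sigma> assume \<sigma>: "\<sigma> \<in> N \<union> U (j + 1)"
      then have "\<sigma> \<in> C" by (auto simp: U_def N_def)
      then have "\<sigma> (2 * j - 1) < \<sigma> (2 * j + 1)"
        unfolding C_iff using j n by simp
      then show "\<sigma> \<in> U j" using \<sigma> by (auto simp: U_def N_def)
    qed
    moreover have "N \<inter> U (j + 1) = {}" by (auto simp: U_def N_def)
    moreover have "finite N" "finite (U (j + 1))" by (auto simp: U_def N_def)
    ultimately show ?thesis using \<open>?W N = 0\<close> by (simp add: sum.union_disjoint)
  qed
  have "?W (U 1) = ?W (U (Suc j))" if "j < m" for j
    using that
  proof (induction j)
    case (Suc j)
    then show ?case using step[of "Suc j"] by simp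
  qed simp
  from this[of "m - 1"] have "?W (U 1) = ?W (U m)" using n by simp
  also have "U m = ascent_class n {1..<n} {}"
  proof -
    have "{1..<n} = insert (n - 1) {1..<n - 1}" using n by auto
    moreover have "n - 1 + 1 = n" "2 * m - 1 = n - 1" using n by auto
    ultimately show ?thesis unfolding U_def C_def ascent_class_def by auto
  qed
  finally have U1: "?W (U 1) = 1" using class_gf_all_ascents[of x n] by (simp add: class_gf_def)
  define \<rho> where "\<rho> = (\<lambda>i. if i \<in> {1..<n} then i + 1 else if i = n then 1 else i)"
  have \<rho>: "\<rho> permutes {1..n}"
  proof -
    have "inj_on \<rho> {1..n}" by (auto simp: inj_on_def \<rho>_def split: if_splits)
    moreover have "\<rho> ` {1..n} \<subseteq> {1..n}" using n by (auto simp: \<rho>_def)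
    ultimately have "bij_betw \<rho> {1..n} {1..n}" by (simp add: bij_betw_def endo_inj_surj)
    then show ?thesis by (rule bij_imp_permutes) (use n in \<open>auto simp: \<rho>_def\<close>)
  qed
  have "C - U 1 = {\<rho>}"
  proof (intro set_eqI iffI)
    fix \<sigma> assume \<sigma>: "\<sigma> \<in> C - U 1"
    then have C: "\<sigma> \<in> C" by blast
    have p: "\<sigma> permutes {1..n}" using C C_iff by blast
    have asc: "\<sigma> i < \<sigma> (i + 1)" if "i \<in> {1..<n - 1}" for i using C that by (auto simp: C_def ascent_class_def)
    have "\<sigma> n \<noteq> \<sigma> 1" using inj[OF C] n by (auto simp: inj_eq)
    then have "\<sigma> n < \<sigma> 1" using \<sigma> by (auto simp: U_def)
    moreover have rng: "1 \<le> \<sigma> i" "\<sigma> i \<le> n" if "1 \<le> i" "i \<le> n" for i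
      using permutes_in_image[OF p, of i] that by auto
    moreover have "1 \<le> \<sigma> n" using rng(1)[of n] n by simp
    ultimately have "2 \<le> \<sigma> 1" by simp
    have val: "\<sigma> i = i + 1" if "i \<in> {1..<n}" for i
    proof -
      have i: "1 \<le> i" "i < n" "i \<le> n - 1" using that by auto
      have "\<sigma> 1 + (i - 1) \<le> \<sigma> i"
        using ascending_gap[of 1 "n - 1" \<sigma> 1 "i - 1", OF asc] i by simp
      moreover have "\<sigma> i + (n - 1 - i) \<le> \<sigma> (n - 1)"
        using ascending_gap[of 1 "n - 1" \<sigma> i "n - 1 - i", OF asc] i by simp
      moreover have "\<sigma> (n - 1) \<le> n" using rng(2)[of "n - 1"] i by simp
      ultimately show ?thesis using i \<open>2 \<le> \<sigma> 1\<close> by linarith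
    qed
    have "\<sigma> n = 1"
    proof (rule ccontr)
      assume "\<sigma> n \<noteq> 1"
      then have "\<sigma> n - 1 \<in> {1..<n}" using rng[of n] n by auto
      moreover from val[OF this] have "\<sigma> (\<sigma> n - 1) = \<sigma> n" using \<open>\<sigma> n - 1 \<in> {1..<n}\<close> by auto
      ultimately show False using inj[OF C] by (auto simp: inj_eq)
    qed
    have "\<sigma> = \<rho>"
    proof
      fix i show "\<sigma> i = \<rho> i"
        using val[of i] \<open>\<sigma> n = 1\<close> permutes_not_in[OF p, of i] by (auto simp: \<rho>_def)
    qed
    then show "\<sigma> \<in> {\<rho>}" by simp
  next
    fix \<sigma> assume "\<sigma> \<in> {\<rho>}"
    then show "\<sigma> \<in> C - U 1" using \<rho> n by (auto simp: C_def U_def ascent_class_def \<rho>_def)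
  qed
  moreover have "signed_weight x n \<rho> = - (x ^ m)"
    using n by (rule signed_weight_rotation) (use n in \<open>auto simp: \<rho>_def\<close>)
  ultimately have "?W (C - U 1) = - (x ^ m)" by simp
  moreover have "?W C = ?W (U 1) + ?W (C - U 1)"
    by (subst sum.subset_diff[of "U 1" C]) (auto simp: U_def add.commute)
  ultimately show ?thesis using U1 by (simp add: class_gf_def C_def)
qed

text \<open>The set \<open>A\<close> makes the induction work: while the later components are
  merged, the first one waits in \<open>A\<close>, still cut into pairs, and is merged last.\<close>

lemma class_gf_intervals:
  assumes x: "x ^ 2 \<noteq> 1"
    and "\<forall>(a, b)\<in>set ivs. 1 \<le> a \<and> a \<le> b \<and> b < n \<and> (A \<union> J) \<inter> {a - 1..b + 1} = {}"
    and "successively (\<lambda>(a, b) (a', b'). b + 1 < a') ivs"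
  shows "class_gf x n (A \<union> (\<Union>(a, b)\<in>set ivs. alternate a (b + 1))) J =
    (\<Prod>(a, b)\<leftarrow>ivs. q_fact (x ^ 2) ((card {a..b} + 1) div 2)) * class_gf x n (A \<union> (\<Union>(a, b)\<in>set ivs. {a..b})) J"
  using assms(2,3)
proof (induction ivs arbitrary: A)
  case (Cons c ivs)
  obtain a b where c: "c = (a, b)" by force
  let ?U = "\<Union>(a, b)\<in>set ivs. {a..b}" and ?V = "\<Union>(a, b)\<in>set ivs. alternate a (b + 1)"
  have ab: "1 \<le> a" "a \<le> b" "b < n" "(A \<union> J) \<inter> {a - 1..b + 1} = {}"
    using Cons.prems c by auto
  have U: "b + 1 < y" if "y \<in> ?U" for y
    using interval_decomp_tail_gt[of a b ivs y] Cons.prems that unfolding c by fastforce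
  have "class_gf x n (A \<union> (alternate a (b + 1) \<union> ?V)) J = class_gf x n ((A \<union> alternate a (b + 1)) \<union> ?V) J"
    by (simp add: Un_assoc)
  also have "\<dots> = (\<Prod>(a, b)\<leftarrow>ivs. q_fact (x ^ 2) ((card {a..b} + 1) div 2)) *
      class_gf x n ((A \<union> alternate a (b + 1)) \<union> ?U) J"
  proof (rule Cons.IH)
    have "(A \<union> alternate a (b + 1) \<union> J) \<inter> {a' - 1..b' + 1} = {}" if "(a', b') \<in> set ivs" for a' b'
    proof -
      have "a' \<le> b'" "(A \<union> J) \<inter> {a' - 1..b' + 1} = {}" using Cons.prems(1) that by auto
      moreover have "a' \<in> ?U" using that calculation(1) by force
      then have "b + 1 < a'" by (rule U)
      then have "alternate a (b + 1) \<inter> {a' - 1..b' + 1} = {}" using alternate_subset[of a "b + 1"] by fastforce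
      ultimately show ?thesis by blast
    qed
    then show "\<forall>(a', b')\<in>set ivs. 1 \<le> a' \<and> a' \<le> b' \<and> b' < n \<and> (A \<union> alternate a (b + 1) \<union> J) \<inter> {a' - 1..b' + 1} = {}"
      using Cons.prems(1) by auto
    show "successively (\<lambda>(a, b) (a', b'). b + 1 < a') ivs"
      using Cons.prems(2) by (auto simp: successively_Cons)
  qed
  also have "(A \<union> alternate a (b + 1)) \<union> ?U = (A \<union> ?U) \<union> alternate a (b + 1)" by blast
  also have "class_gf x n ((A \<union> ?U) \<union> alternate a (b + 1)) J =
      q_fact (x ^ 2) ((b + 1 - a + 1) div 2) * class_gf x n ((A \<union> ?U) \<union> {a..<b + 1}) J"
  proof (rule class_gf_alternate[OF x])
    have "y \<notin> {a - 1..b + 1}" if "y \<in> ?U" for y using U[OF that] by simp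
    then show "(A \<union> ?U \<union> J) \<inter> {a - 1..b + 1} = {}" using ab(4) by blast
  qed (use ab in auto)
  also have "(A \<union> ?U) \<union> {a..<b + 1} = A \<union> ({a..b} \<union> ?U)" by auto
  also have "b + 1 - a + 1 = card {a..b} + 1" by simp
  finally show ?case by (simp add: c mult.left_commute mult.commute)
qed simp

section \<open>Flipping a descent pair by means of a free position\<close>

definition separated :: "nat set \<Rightarrow> bool" where
  "separated K \<longleftrightarrow> (\<forall>i\<in>K. i + 1 \<notin> K)"

lemma separated_predD: "separated K \<Longrightarrow> i \<in> K \<Longrightarrow> 1 \<le> i \<Longrightarrow> i - 1 \<notin> K"
  by (metis le_add_diff_inverse2 separated_def)

lemma separated_succD: "separated K \<Longrightarrow> i \<in> K \<Longrightarrow> i + 1 \<notin> K"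
  by (simp add: separated_def)

text \<open>Position \<open>s\<close> is free because neither \<open>s - 1\<close> nor
  \<open>s\<close> carries a condition. It travels left until it touches the pair at
  \<open>p\<close>: a pair in its way is shifted past it, and shifted back after the flip.\<close>

lemma flip_descent_right:
  assumes "separated (I \<union> J)" "I \<inter> J = {}" "I \<union> J \<subseteq> {1..<n}" "p \<in> J"
    and "s \<le> n" "s \<notin> I \<union> J" "s - 1 \<notin> I \<union> J" "p < s"
  shows "class_gf x n I J = - (x ^ 2) * class_gf x n (insert p I) (J - {p})"
  using assms
proof (induction s arbitrary: I J rule: less_induct)
  case (less s)
  note sep = less.prems(1) and disj = less.prems(2) and sub = less.prems(3) and p = less.prems(4)
  have p1: "1 \<le> p" "p \<notin> I" using disj sub p by auto
  have p2: "p - 1 \<notin> I \<union> J" "p + 1 \<notin> I \<union> J"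
    using separated_predD[OF sep, of p] separated_succD[OF sep, of p] p p1 by blast+
  have "s \<noteq> p + 1" using less.prems p by auto
  then consider "s = p + 2" | "p + 2 < s" "s - 2 \<notin> I \<union> J" | "p + 2 < s" "s - 2 \<in> I" | "p + 2 < s" "s - 2 \<in> J"
    using less.prems by force
  then show ?case
  proof cases
    case 1
    have "(I \<union> (J - {p})) \<inter> {p - 1..p + 2} = {}"
    proof -
      have "y = p - 1 \<or> y = p \<or> y = p + 1 \<or> y = p + 2" if "y \<in> {p - 1..p + 2}" for y using that by auto
      then show ?thesis using p1 p2 less.prems 1 by blast
    qed
    from class_gf_descent_to_ascent[OF p1(1) _ this, of n x] show ?thesis
      using 1 less.prems(4,5) by (simp add: insert_absorb)
  next
    case 2
    moreover have "s - 1 - 1 = s - 2" by simp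
    ultimately show ?thesis using less.IH[of "s - 1" I J] less.prems by simp
  next
    case 3
    define q where "q = s - 2"
    have s: "s = q + 2" and q: "q \<in> I" "p < q" using 3 by (auto simp: q_def)
    have "1 \<le> q" using sub q by auto
    then have q1: "1 \<le> q" "q - 1 \<notin> I \<union> J" "q + 1 \<notin> I \<union> J" "q + 2 \<notin> I \<union> J" "q \<notin> J"
      using disj separated_predD[OF sep, of q] separated_succD[OF sep, of q] q less.prems(6) s by blast+
    have free: "((I - {q}) \<union> J) \<inter> {q - 1..q + 2} = {}"
    proof -
      have "y = q - 1 \<or> y = q \<or> y = q + 1 \<or> y = q + 2" if "y \<in> {q - 1..q + 2}" for y using that by auto
      then show ?thesis using q1 by blast
    qed
    let ?I = "insert (q + 1) (I - {q})"
    have "class_gf x n I J = class_gf x n ?I J"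
      using class_gf_shift_ascent[OF q1(1) _ free, of n x] less.prems(5) q s by (simp add: insert_absorb)
    also have "\<dots> = - (x ^ 2) * class_gf x n (insert p ?I) (J - {p})"
    proof (rule less.IH[of q])
      show "separated (?I \<union> J)" using sep q1 unfolding separated_def by auto
      show "?I \<union> J \<subseteq> {1..<n}" using sub less.prems(5) s by auto
    qed (use q q1 less.prems s in auto)
    also have "insert p ?I = insert (q + 1) (insert p (I - {q}))" by (simp add: insert_commute)
    also have "class_gf x n \<dots> (J - {p}) = class_gf x n (insert q (insert p (I - {q}))) (J - {p})"
    proof (rule class_gf_shift_ascent[OF q1(1)])
      show "(insert p (I - {q}) \<union> (J - {p})) \<inter> {q - 1..q + 2} = {}" using free p by blast
    qed (use less.prems s in auto)
    also have "insert q (insert p (I - {q})) = insert p I" using q by blast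
    finally show ?thesis .
  next
    case 4
    define q where "q = s - 2"
    have s: "s = q + 2" and q: "q \<in> J" "p < q" using 4 by (auto simp: q_def)
    have "1 \<le> q" using sub q by auto
    then have q1: "1 \<le> q" "q - 1 \<notin> I \<union> J" "q + 1 \<notin> I \<union> J" "q + 2 \<notin> I \<union> J" "q \<notin> I"
      using disj separated_predD[OF sep, of q] separated_succD[OF sep, of q] q less.prems(6) s by blast+
    have free: "(I \<union> (J - {q})) \<inter> {q - 1..q + 2} = {}"
    proof -
      have "y = q - 1 \<or> y = q \<or> y = q + 1 \<or> y = q + 2" if "y \<in> {q - 1..q + 2}" for y using that by auto
      then show ?thesis using q1 by blast
    qed
    let ?J = "insert (q + 1) (J - {q})"
    have "class_gf x n I J = class_gf x n I ?J"
      using class_gf_shift_descent[OF q1(1) _ free, of n x] less.prems(5) q s by (simp add: insert_absorb)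
    also have "\<dots> = - (x ^ 2) * class_gf x n (insert p I) (?J - {p})"
    proof (rule less.IH[of q])
      show "separated (I \<union> ?J)" using sep q1 unfolding separated_def by auto
      show "I \<union> ?J \<subseteq> {1..<n}" using sub less.prems(5) s by auto
    qed (use q q1 less.prems s in auto)
    also have "?J - {p} = insert (q + 1) (J - {p} - {q})" using q by auto
    also have "class_gf x n (insert p I) \<dots> = class_gf x n (insert p I) (insert q (J - {p} - {q}))"
    proof (rule class_gf_shift_descent[OF q1(1)])
      show "(insert p I \<union> (J - {p} - {q})) \<inter> {q - 1..q + 2} = {}" using free p q by blast
    qed (use less.prems s in auto)
    also have "insert q (J - {p} - {q}) = J - {p}" using q by blast
    finally show ?thesis .
  qed
qed

text \<open>The mirror image, with the free position travelling right. As
  \<open>class_gf_descent_to_ascent\<close> wants the free position to the right of the pair, the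
  pair finally moves down to \<open>s\<close>, flips there and moves back.\<close>

lemma flip_descent_left:
  assumes "separated (I \<union> J)" "I \<inter> J = {}" "I \<union> J \<subseteq> {1..<n}" "p \<in> J"
    and "1 \<le> s" "s \<notin> I \<union> J" "s - 1 \<notin> I \<union> J" "s < p"
  shows "class_gf x n I J = - (x ^ 2) * class_gf x n (insert p I) (J - {p})"
  using assms
proof (induction "p - s" arbitrary: s I J rule: less_induct)
  case less
  note sep = less.prems(1) and disj = less.prems(2) and sub = less.prems(3) and p = less.prems(4)
  have p1: "p < n" "p + 1 \<notin> I \<union> J" "p \<notin> I" using sep disj sub p by (auto simp: separated_def)
  have surround: "y = s - 1 \<or> y = s \<or> y = s + 1 \<or> y = s + 2" if "y \<in> {s - 1..s + 2}" for y using that by auto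
  consider "p = s + 1" | "s + 1 < p" "s + 1 \<notin> I \<union> J" | "s + 1 < p" "s + 1 \<in> I" | "s + 1 < p" "s + 1 \<in> J"
    using less.prems by force
  then show ?case
  proof cases
    case 1
    have free: "(I \<union> (J - {p})) \<inter> {s - 1..s + 2} = {}"
      using surround p1 less.prems 1 by fastforce
    have n: "s + 2 \<le> n" using p1 1 by simp
    have "class_gf x n I J = class_gf x n I (insert (s + 1) (J - {p}))"
      using 1 p by (simp add: insert_absorb)
    also have "\<dots> = - (x ^ 2) * class_gf x n (insert p I) (J - {p})"
      using class_gf_shift_descent[OF less.prems(5) n free, of x]
        class_gf_descent_to_ascent[OF less.prems(5) n free, of x]
        class_gf_shift_ascent[OF less.prems(5) n free, of x] 1 by simp
    finally show ?thesis .
  next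
    case 2
    then show ?thesis using less.hyps[of "s + 1" I J] less.prems by simp
  next
    case 3
    have s2: "s + 2 \<notin> I \<union> J" "s + 1 \<notin> J" using sep disj 3 by (auto simp: separated_def)
    have n: "s + 2 \<le> n" using p1 3 by simp
    have free: "((I - {s + 1}) \<union> J) \<inter> {s - 1..s + 2} = {}"
      using surround s2 less.prems by fastforce
    have "s + 2 < p" using 3 s2 p by (cases "p = s + 2") auto
    let ?I = "insert s (I - {s + 1})"
    have "class_gf x n I J = class_gf x n ?I J"
      using class_gf_shift_ascent[OF less.prems(5) n free, of x] 3 by (simp add: insert_absorb)
    also have "\<dots> = - (x ^ 2) * class_gf x n (insert p ?I) (J - {p})"
    proof (rule less.hyps[of "s + 2"])
      show "separated (?I \<union> J)"
        using sep s2 less.prems(5-7) unfolding separated_def by (auto simp: Suc_diff_Suc)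
      show "?I \<union> J \<subseteq> {1..<n}" using sub less.prems(5) n by auto
    qed (use \<open>s + 2 < p\<close> s2 less.prems in auto)
    also have "insert p ?I = insert s (insert p (I - {s + 1}))" by (simp add: insert_commute)
    also have "class_gf x n \<dots> (J - {p}) = class_gf x n (insert (s + 1) (insert p (I - {s + 1}))) (J - {p})"
    proof (rule class_gf_shift_ascent[OF less.prems(5) n, symmetric])
      show "(insert p (I - {s + 1}) \<union> (J - {p})) \<inter> {s - 1..s + 2} = {}" using free p by blast
    qed
    also have "insert (s + 1) (insert p (I - {s + 1})) = insert p I" using 3 by blast
    finally show ?thesis .
  next
    case 4
    have s2: "s + 2 \<notin> I \<union> J" "s + 1 \<notin> I" using sep disj 4 by (auto simp: separated_def)
    have n: "s + 2 \<le> n" using p1 4 by simp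
    have free: "(I \<union> (J - {s + 1})) \<inter> {s - 1..s + 2} = {}"
      using surround s2 less.prems by fastforce
    have "s + 2 < p" using 4 s2 p by (cases "p = s + 2") auto
    let ?J = "insert s (J - {s + 1})"
    have "class_gf x n I J = class_gf x n I ?J"
      using class_gf_shift_descent[OF less.prems(5) n free, of x] 4 by (simp add: insert_absorb)
    also have "\<dots> = - (x ^ 2) * class_gf x n (insert p I) (?J - {p})"
    proof (rule less.hyps[of "s + 2"])
      show "separated (I \<union> ?J)"
        using sep s2 less.prems(5-7) unfolding separated_def by (auto simp: Suc_diff_Suc)
      show "I \<union> ?J \<subseteq> {1..<n}" using sub less.prems(5) n by auto
    qed (use \<open>s + 2 < p\<close> s2 less.prems in auto)
    also have "?J - {p} = insert s (J - {p} - {s + 1})" using less.prems(8) by auto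
    also have "class_gf x n (insert p I) \<dots> = class_gf x n (insert p I) (insert (s + 1) (J - {p} - {s + 1}))"
    proof (rule class_gf_shift_descent[OF less.prems(5) n, symmetric])
      show "(insert p I \<union> (J - {p} - {s + 1})) \<inter> {s - 1..s + 2} = {}" using free p 4 by blast
    qed
    also have "insert (s + 1) (J - {p} - {s + 1}) = J - {p}" using 4 by auto
    finally show ?thesis .
  qed
qed

subsection \<open>Isolated pairs\<close>

text \<open>Each index of \<open>K\<close> covers two positions, so fewer than \<open>n\<close>
  positions are covered.\<close>

lemma separated_gap:
  assumes "K \<subseteq> {1..<n}" "2 * card K < n"
  obtains s where "1 \<le> s" "s \<le> n" "s \<notin> K" "s - 1 \<notin> K"
proof -
  have "finite K" using assms(1) finite_subset by blast
  have "\<not> {1..n} \<subseteq> K \<union> Suc ` K"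
  proof
    assume "{1..n} \<subseteq> K \<union> Suc ` K"
    then have "n \<le> card (K \<union> Suc ` K)"
      using card_mono[of "K \<union> Suc ` K" "{1..n}"] \<open>finite K\<close> by simp
    also have "\<dots> \<le> card K + card (Suc ` K)" by (rule card_Un_le)
    also have "\<dots> \<le> 2 * card K" using card_image_le[OF \<open>finite K\<close>, of Suc] by simp
    finally show False using assms(2) by simp
  qed
  then obtain s where s: "s \<in> {1..n}" "s \<notin> K" "s \<notin> Suc ` K" by blast
  then have "s - 1 \<notin> K" by (metis Suc_diff_1 atLeastAtMost_iff image_eqI less_eq_Suc_le One_nat_def)
  with s that show ?thesis by auto
qed

text \<open>A flip leaves \<open>I \<union> J\<close> unchanged, so a free position remains
  available for the next one.\<close>

lemma class_gf_flip_all: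
  assumes "separated (I \<union> J)" "I \<inter> J = {}" "I \<union> J \<subseteq> {1..<n}" "2 * card (I \<union> J) < n"
  shows "class_gf x n I J = (- (x ^ 2)) ^ card J * class_gf x n (I \<union> J) {}"
proof -
  have "finite J" using assms(3) finite_subset by blast
  then show ?thesis using assms
  proof (induction J arbitrary: I rule: finite_induct)
    case (insert p J)
    obtain s where s: "1 \<le> s" "s \<le> n" "s \<notin> I \<union> insert p J" "s - 1 \<notin> I \<union> insert p J"
      using separated_gap[OF insert.prems(3,4)] .
    have "class_gf x n I (insert p J) = - (x ^ 2) * class_gf x n (insert p I) (insert p J - {p})"
    proof (cases "p < s")
      case True
      then show ?thesis using insert.prems s by (intro flip_descent_right[of I "insert p J" n p s]) auto
    next
      case False
      then have "s < p" using s by (cases "s = p") auto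
      then show ?thesis using insert.prems s by (intro flip_descent_left[of I "insert p J" n p s]) auto
    qed
    also have "insert p J - {p} = J" using insert.hyps by blast
    also have "class_gf x n (insert p I) J = (- (x ^ 2)) ^ card J * class_gf x n (insert p I \<union> J) {}"
      using insert.hyps insert.prems by (intro insert.IH) auto
    finally show ?case using insert.hyps by simp
  qed simp
qed

text \<open>A pair with a free position on its left moves down by one, which lowers the sum of the
  indices. If no pair can move, the indices are consecutive odd numbers from 1 on.\<close>

lemma class_gf_push_left:
  assumes "separated I" "I \<subseteq> {1..<n}"
  shows "class_gf x n I {} = class_gf x n ((\<lambda>i. 2 * i + 1) ` {..<card I}) {}"
  using assms
proof (induction "\<Sum>I" arbitrary: I rule: less_induct)
  case less
  have fin: "finite I" using less.prems(2) finite_subset by blast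
  show ?case
  \<comment> \<open>For \<open>q = 2\<close> the difference is 0, which lies outside
    \<open>I\<close>, so this pair rightly counts as movable.\<close>
  proof (cases "\<exists>q\<in>I. q \<noteq> 1 \<and> q - 2 \<notin> I")
    case True
    then obtain q where q: "q \<in> I" "q \<noteq> 1" "q - 2 \<notin> I" by blast
    define p where "p = q - 1"
    have p: "q = p + 1" "1 \<le> p" "p + 2 \<le> n" using q subsetD[OF less.prems(2) q(1)] by (auto simp: p_def)
    have pI: "p - 1 \<notin> I" "p \<notin> I" "p + 2 \<notin> I"
      using separated_predD[OF less.prems(1) q(1)] separated_succD[OF less.prems(1) q(1)] q p by auto
    let ?I = "I - {p + 1}"
    have free: "(?I \<union> {}) \<inter> {p - 1..p + 2} = {}"
    proof -
      have "y = p - 1 \<or> y = p \<or> y = p + 1 \<or> y = p + 2" if "y \<in> {p - 1..p + 2}" for y using that by auto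
      then show ?thesis using pI by blast
    qed
    have I: "insert (p + 1) ?I = I" using q p by auto
    have "card (insert p ?I) = card I" using card_Suc_Diff1[OF fin, of q] fin pI q p by simp
    moreover have "\<Sum>(insert p ?I) < \<Sum>I"
      using sum.remove[OF fin q(1), of "\<lambda>i. i"] fin pI p by simp
    moreover have "separated (insert p ?I)"
      using less.prems(1) pI p(2) unfolding separated_def by (auto simp: Suc_diff_Suc)
    moreover have "insert p ?I \<subseteq> {1..<n}" using less.prems(2) p by auto
    ultimately have "class_gf x n (insert p ?I) {} = class_gf x n ((\<lambda>i. 2 * i + 1) ` {..<card I}) {}"
      using less.hyps by metis
    then show ?thesis using class_gf_shift_ascent[OF p(2,3) free, of x] I by simp
  next
    case False
    \<comment> \<open>Going down by 2 from an index of \<open>I\<close> stays in \<open>I\<close>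
      until 1 is reached.\<close>
    have odd: "odd q \<and> (\<forall>k. 2 * k + 1 \<le> q \<longrightarrow> 2 * k + 1 \<in> I)" if "q \<in> I" for q
      using that
    proof (induction q rule: less_induct)
      case (less q)
      show ?case
      proof (cases "q = 1")
        case False
        then have q2: "q - 2 \<in> I" using less.prems \<open>\<not> (\<exists>q\<in>I. _ q)\<close> by blast
        then have "1 \<le> q - 2" using \<open>I \<subseteq> {1..<n}\<close> by fastforce
        then have IH: "odd (q - 2)" "\<And>k. 2 * k + 1 \<le> q - 2 \<Longrightarrow> 2 * k + 1 \<in> I" using less.IH[OF _ q2] by auto
        then have "odd q" using \<open>1 \<le> q - 2\<close> by simp
        moreover have "2 * k + 1 \<in> I" if "2 * k + 1 \<le> q" for k
        proof (cases "2 * k + 1 = q")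
          case False
          then have "2 * k + 1 \<le> q - 2" using that \<open>odd q\<close> by presburger
          then show ?thesis by (rule IH(2))
        qed (use less.prems in simp)
        ultimately show ?thesis by blast
      qed (use less.prems in auto)
    qed
    define H where "H = {k. 2 * k + 1 \<in> I}"
    have IH: "I = (\<lambda>i. 2 * i + 1) ` H"
    proof (intro equalityI subsetI)
      fix i assume "i \<in> I"
      moreover from this odd obtain k where "i = 2 * k + 1" by (blast elim: oddE)
      ultimately show "i \<in> (\<lambda>i. 2 * i + 1) ` H" by (simp add: H_def)
    qed (auto simp: H_def)
    have inj: "inj_on (\<lambda>i :: nat. 2 * i + 1) A" for A by (auto simp: inj_on_def)
    have "finite ((\<lambda>i. 2 * i + 1) ` H)" using fin by (simp only: IH[symmetric])
    then have "finite H" by (rule finite_imageD[OF _ inj])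
    have "H = {..<card H}"
    proof (cases "H = {}")
      case ne: False
      have "H = {..Max H}"
      proof (intro equalityI subsetI)
        fix k assume "k \<in> {..Max H}"
        then have "2 * k + 1 \<le> 2 * Max H + 1" by simp
        moreover have "2 * Max H + 1 \<in> I" using Max_in[OF \<open>finite H\<close> ne] by (simp add: H_def)
        ultimately have "2 * k + 1 \<in> I" using odd by blast
        then show "k \<in> H" by (simp add: H_def)
      qed (use \<open>finite H\<close> in auto)
      then have "H = {..<Suc (Max H)}" by (simp only: lessThan_Suc_atMost)
      then show ?thesis by (metis card_lessThan)
    qed simp
    moreover have "card I = card H" using card_image[OF inj, of H] by (simp only: IH[symmetric])
    ultimately have "(\<lambda>i. 2 * i + 1) ` {..<card I} = I" using IH by argo
    then show ?thesis by (simp only:)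
  qed
qed

lemma alternate_eq_odds: "alternate 1 b = (\<lambda>i. 2 * i + 1) ` {..<b div 2}"
proof (intro set_eqI iffI)
  fix i assume i: "i \<in> alternate 1 b"
  then obtain k where "i = 2 * k + 1" by (auto simp: alternate_def elim: oddE)
  then show "i \<in> (\<lambda>i. 2 * i + 1) ` {..<b div 2}"
    using i by (intro image_eqI[of _ _ k]) (auto simp: alternate_def)
qed (auto simp: alternate_def)

text \<open>A block of \<open>2 * M + 1\<close> positions also cuts into \<open>M\<close> pairs, so
  the first free position joins the merged block at no extra cost. This settles one or two free
  positions; with three or more, a further pair is created.\<close>

lemma class_gf_odds:
  assumes x: "x ^ 2 \<noteq> 1" and M: "2 * M < n"
  shows "class_gf x n ((\<lambda>i. 2 * i + 1) ` {..<M}) {} =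
    q_fact (x ^ 2) M * (\<Prod>k = 2 * M + 2..n. 1 + (- 1) ^ (k - 1) * x ^ (k div 2))"
  using M
proof (induction "n - 2 * M" arbitrary: M rule: less_induct)
  case less
  let ?O = "\<lambda>M. (\<lambda>i :: nat. 2 * i + 1) ` {..<M}"
  let ?f = "\<lambda>k. 1 + (- 1) ^ (k - 1) * x ^ (k div 2)"
  have block: "class_gf x n (?O M) {} = q_fact (x ^ 2) M * class_gf x n {1..<2 * M + 1} {}"
    using class_gf_alternate[OF x, of 1 "2 * M + 1" n "{}" "{}"] less.prems alternate_eq_odds[of "2 * M + 1"] by simp
  consider "n = 2 * M + 1" | "n = 2 * M + 2" | "2 * M + 3 \<le> n" using less.prems by linarith
  then show ?case
  proof cases
    case 1
    then show ?thesis using block class_gf_all_ascents[of x n] by simp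
  next
    case 2
    then have "class_gf x n {1..<2 * M + 1} {} = 1 - x ^ (M + 1)"
      using class_gf_all_but_last[of n "M + 1" x] by simp
    then show ?thesis using 2 block by simp
  next
    case 3
    have free: "(?O M \<union> {}) \<inter> {2 * M + 1 - 1..2 * M + 1 + 2} = {}" by auto
    have "class_gf x n (?O M) {} = (1 - x ^ 2) * class_gf x n (insert (2 * M + 1) (?O M)) {}"
      using class_gf_free_triple[OF _ _ free, of n x] 3 by simp
    also have "insert (2 * M + 1) (?O M) = ?O (M + 1)" by (simp add: lessThan_Suc)
    also have "class_gf x n (?O (M + 1)) {} = q_fact (x ^ 2) (M + 1) * (\<Prod>k = 2 * (M + 1) + 2..n. ?f k)"
      using 3 by (intro less.hyps) auto
    also have "(1 - x ^ 2) * (q_fact (x ^ 2) (M + 1) * (\<Prod>k = 2 * (M + 1) + 2..n. ?f k)) =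
        q_fact (x ^ 2) M * (((1 - x ^ 2) * q_int (x ^ 2) (M + 1)) * (\<Prod>k = 2 * (M + 1) + 2..n. ?f k))"
      by (simp add: q_fact_Suc mult_ac)
    \<comment> \<open>The cost of the new pair and the new q-integer combine to the factors for
      \<open>k = 2 * M + 2\<close> and \<open>k = 2 * M + 3\<close>.\<close>
    also have "(1 - x ^ 2) * q_int (x ^ 2) (M + 1) = ?f (2 * M + 2) * ?f (2 * M + 3)"
    proof -
      have "(1 - x ^ 2) * q_int (x ^ 2) (M + 1) = 1 - (x ^ 2) ^ (M + 1)"
        using x by (simp add: q_int_def)
      also have "\<dots> = (1 - x ^ (M + 1)) * (1 + x ^ (M + 1))"
        by (simp add: algebra_simps power2_eq_square power_mult_distrib)
      finally show ?thesis by simp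
    qed
    also have "(\<Prod>k = 2 * M + 2..n. ?f k) = ?f (2 * M + 2) * ?f (2 * M + 3) * (\<Prod>k = 2 * (M + 1) + 2..n. ?f k)"
    proof -
      have "{2 * M + 2..n} = insert (2 * M + 2) (insert (2 * M + 3) {2 * (M + 1) + 2..n})" using 3 by auto
      then show ?thesis by (simp add: mult.assoc)
    qed
    then have "q_fact (x ^ 2) M * (?f (2 * M + 2) * ?f (2 * M + 3) * (\<Prod>k = 2 * (M + 1) + 2..n. ?f k)) =
        q_fact (x ^ 2) M * (\<Prod>k = 2 * M + 2..n. ?f k)" by simp
    finally show ?thesis .
  qed
qed

lemma class_gf_separated:
  assumes x: "x ^ 2 \<noteq> 1"
    and "separated (I \<union> J)" "I \<inter> J = {}" "I \<union> J \<subseteq> {1..<n}" "2 * card (I \<union> J) < n"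
  shows "class_gf x n I J = (- (x ^ 2)) ^ card J * (q_fact (x ^ 2) (card (I \<union> J)) *
    (\<Prod>k = 2 * card (I \<union> J) + 2..n. 1 + (- 1) ^ (k - 1) * x ^ (k div 2)))"
  using class_gf_flip_all[OF assms(2-5)] class_gf_push_left[OF assms(2,4)] class_gf_odds[OF x assms(5)] by metis

text \<open>Releasing the condition at one descent pair frees two positions, and
  \<open>class_gf_separated\<close> evaluates the result. It is the wanted class plus the one with
  an ascent there, which has one descent pair fewer. The factor \<open>[M - 1]!\<close> is
  \<open>[M]! / [M]\<close> written without division.\<close>

lemma class_gf_separated_full:
  assumes x: "x ^ 2 \<noteq> 1" and "1 \<le> n"
    and "separated (I \<union> J)" "I \<inter> J = {}" "I \<union> J \<subseteq> {1..<n}" "n = 2 * card (I \<union> J)"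
  shows "class_gf x n I J = (- x) ^ card J *
    (x ^ card J * q_int (x ^ 2) (card I) + x ^ card I * q_int (x ^ 2) (card J)) * q_fact (x ^ 2) (card (I \<union> J) - 1)"
proof -
  have "finite J" using assms(5) finite_subset by blast
  then show ?thesis using assms(3-6)
  proof (induction J arbitrary: I rule: finite_induct)
    case empty
    define M where "M = card I - 1"
    have M: "card I = Suc M" using empty assms(2) by (simp add: M_def)
    have "class_gf x n I {} = class_gf x n (alternate 1 n) {}"
      using class_gf_push_left[of I n x] empty alternate_eq_odds[of n] by simp
    also have "\<dots> = q_fact (x ^ 2) (card I)"
      using class_gf_alternate[OF x, of 1 n n "{}" "{}"] class_gf_all_ascents[of x n] empty assms(2) by simp
    finally show ?case by (simp add: M q_fact_Suc q_int_def)
  next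
    case (insert p J)
    define b e where "b = card I" and "e = card J"
    have fin: "finite I" using insert.prems(3) finite_subset by blast
    have pI: "p \<notin> I" using insert.prems by blast
    have ins: "insert p I \<union> J = I \<union> insert p J" by blast
    have disj: "I \<inter> J = {}" using insert.prems by blast
    have M: "card (I \<union> insert p J) = b + e + 1" "card (I \<union> J) = b + e"
      using fin insert.hyps insert.prems(2) disj by (simp_all add: card_Un_disjoint b_def e_def)
    then have n: "n = 2 * (b + e + 1)" using insert.prems by simp
    let ?q = "q_int (x ^ 2)"
    let ?F = "q_fact (x ^ 2) (b + e)"
    have "class_gf x n I J = class_gf x n (insert p I) J + class_gf x n I (insert p J)"
      by (rule class_gf_split)
    moreover have "class_gf x n I J = (- (x ^ 2)) ^ e * (?F * (1 - x ^ (b + e + 1)))"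
    proof -
      have "separated (I \<union> J)" using insert.prems(1) by (auto simp: separated_def)
      moreover have "I \<union> J \<subseteq> {1..<n}" using insert.prems(3) by blast
      ultimately show ?thesis
        using class_gf_separated[OF x _ disj, of n] n by (simp add: M e_def[symmetric])
    qed
    moreover have "class_gf x n (insert p I) J =
        (- x) ^ e * (x ^ e * ?q (b + 1) + x ^ (b + 1) * ?q e) * ?F"
      using insert.IH[of "insert p I"] insert.prems insert.hyps fin pI M
      by (simp add: ins b_def[symmetric] e_def[symmetric])
    ultimately have "class_gf x n I (insert p J) =
        (- (x ^ 2)) ^ e * (?F * (1 - x ^ (b + e + 1))) - (- x) ^ e * (x ^ e * ?q (b + 1) + x ^ (b + 1) * ?q e) * ?F"
      by simp
    also have "\<dots> = (- x) ^ (e + 1) * (x ^ (e + 1) * ?q b + x ^ b * ?q (e + 1)) * ?F"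
    proof -
      \<comment> \<open>\<open>[b + 1]\<close> is expanded at its lowest term and
        \<open>[e + 1]\<close> at its highest; the lone power \<open>x ^ e\<close> then cancels and
        the rest matches.\<close>
      have "?q (b + 1) = 1 + x ^ 2 * ?q b"
        using x by (simp add: q_int_eq_sum sum.lessThan_Suc_shift sum_distrib_left del: sum.lessThan_Suc)
      moreover have "?q (e + 1) = ?q e + x ^ e * x ^ e"
        using x by (simp add: q_int_eq_sum power2_eq_square power_mult_distrib)
      moreover have "(- (x ^ 2)) ^ e = (- x) ^ e * x ^ e"
        by (simp add: power2_eq_square flip: power_mult_distrib)
      ultimately show ?thesis by (simp add: power2_eq_square power_add algebra_simps)
    qed
    finally show ?case using M insert.hyps by (simp add: b_def e_def)
  qed
qed

text \<open>Pairs of one component have indices up to \<open>b\<close>, and the next component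
  starts beyond \<open>b + 1\<close>, so pairs of different components never have adjacent
  indices.\<close>

lemma alternates_separated_card:
  assumes "\<forall>(a, b)\<in>set ivs. a \<le> b" "successively (\<lambda>(a, b) (a', b'). b + 1 < a') ivs"
  shows "separated (\<Union>(a, b)\<in>set ivs. alternate a (b + 1)) \<and>
    card (\<Union>(a, b)\<in>set ivs. alternate a (b + 1)) = (\<Sum>(a, b)\<leftarrow>ivs. (card {a..b} + 1) div 2)"
  using assms
proof (induction ivs)
  case (Cons c ivs)
  obtain a b where c: "c = (a, b)" by force
  let ?V = "\<Union>(a, b)\<in>set ivs. alternate a (b + 1)" and ?A = "alternate a (b + 1)"
  have "?V \<subseteq> (\<Union>(a, b)\<in>set ivs. {a..b})" using alternate_subset by fastforce
  then have V: "b + 1 < y" if "y \<in> ?V" for y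
    using interval_decomp_tail_gt[of a b ivs y] Cons.prems that unfolding c by blast
  have A: "y \<le> b" if "y \<in> ?A" for y using that alternate_subset by fastforce
  have IH: "separated ?V" "card ?V = (\<Sum>(a, b)\<leftarrow>ivs. (card {a..b} + 1) div 2)"
    using Cons.IH Cons.prems by (auto simp: successively_Cons)
  have "separated ?A" by (auto simp: separated_def alternate_def)
  have "separated (?A \<union> ?V)"
    unfolding separated_def
  proof
    fix i assume "i \<in> ?A \<union> ?V"
    then show "i + 1 \<notin> ?A \<union> ?V"
    proof
      assume "i \<in> ?A"
      then show ?thesis using separated_succD[OF \<open>separated ?A\<close>, of i] A[of i] V[of "i + 1"] by auto
    next
      assume "i \<in> ?V"
      then show ?thesis using separated_succD[OF IH(1), of i] V[of i] A[of "i + 1"] by auto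
    qed
  qed
  moreover have "card (?A \<union> ?V) = card ?A + card ?V"
  proof (rule card_Un_disjoint)
    show "?A \<inter> ?V = {}" using A V by fastforce
  qed (auto simp: alternate_def)
  moreover have "card ?A = (card {a..b} + 1) div 2" by (simp add: card_alternate)
  ultimately show ?case using IH(2) by (simp add: c)
qed (simp add: separated_def)

subsection \<open>Unmixed classes\<close>

text \<open>The pairs cover disjoint positions. Hence \<open>n \<noteq> 2 * M\<close> already means
  that some position is free.\<close>

lemma separated_card_le:
  assumes "separated K" "K \<subseteq> {1..<n}"
  shows "2 * card K \<le> n"
proof -
  have "finite K" using assms(2) finite_subset by blast
  have "K \<inter> Suc ` K = {}" using assms(1) by (auto simp: separated_def)
  then have "card (K \<union> Suc ` K) = 2 * card K"
    using \<open>finite K\<close> by (simp add: card_Un_disjoint card_image)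
  moreover have "K \<union> Suc ` K \<subseteq> {1..n}" using assms(2) by auto
  ultimately show ?thesis using card_mono[of "{1..n}" "K \<union> Suc ` K"] by simp
qed

text \<open>This is the room around a component that \<open>class_gf_alternate\<close> asks
  for.\<close>

lemma unmixed_interval:
  assumes "unmixed I J" "{a..b} \<subseteq> I" "1 \<le> a" "a \<le> b"
  shows "J \<inter> {a - 1..b + 1} = {}"
proof -
  have "a - 1 \<notin> J"
  proof
    assume "a - 1 \<in> J"
    then have "a \<in> (\<lambda>j. j + 1) ` J" using assms(3) by (intro image_eqI[of _ _ "a - 1"]) auto
    moreover have "a \<in> I" using assms(2,4) by auto
    ultimately show False using assms(1) unfolding unmixed_def by blast
  qed
  moreover have "b \<in> I" using assms(2,4) by auto
  then have "b + 1 \<notin> J" using assms(1) unfolding unmixed_def by blast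
  moreover have "y = a - 1 \<or> y \<in> {a..b} \<or> y = b + 1" if "y \<in> {a - 1..b + 1}" for y using that by auto
  moreover have "I \<inter> J = {}" using assms(1) by (simp add: unmixed_def)
  ultimately show ?thesis using assms(2) by blast
qed

lemma alternates_subset:
  assumes "interval_decomp K ivs"
  shows "(\<Union>(a, b)\<in>set ivs. alternate a (b + 1)) \<subseteq> K"
proof -
  have "(\<Union>(a, b)\<in>set ivs. alternate a (b + 1)) \<subseteq> (\<Union>(a, b)\<in>set ivs. {a..b})"
    by (intro UN_mono) (auto simp: alternate_def)
  then show ?thesis using assms by (simp add: interval_decomp_def)
qed

lemma class_gf_components:
  assumes "x ^ 2 \<noteq> 1" "interval_decomp I ivs" "I \<subseteq> {1..<n}" "unmixed I J"
  shows "class_gf x n (\<Union>(a, b)\<in>set ivs. alternate a (b + 1)) J =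
    (\<Prod>(a, b)\<leftarrow>ivs. q_fact (x ^ 2) ((card {a..b} + 1) div 2)) * class_gf x n I J"
proof -
  have I: "I = (\<Union>(a, b)\<in>set ivs. {a..b})" and le: "\<forall>(a, b)\<in>set ivs. a \<le> b"
    and succ: "successively (\<lambda>(a, b) (a', b'). b + 1 < a') ivs"
    using assms(2) by (auto simp: interval_decomp_def)
  have "1 \<le> a \<and> a \<le> b \<and> b < n \<and> ({} \<union> J) \<inter> {a - 1..b + 1} = {}" if "(a, b) \<in> set ivs" for a b
  proof -
    have "a \<le> b" "{a..b} \<subseteq> I" using le that I by auto
    moreover from this have "a \<in> I" "b \<in> I" by auto
    then have "a \<in> {1..<n}" "b \<in> {1..<n}" using assms(3) by blast+
    ultimately show ?thesis using unmixed_interval[OF assms(4), of a b] by auto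
  qed
  then have "\<forall>(a, b)\<in>set ivs. 1 \<le> a \<and> a \<le> b \<and> b < n \<and> ({} \<union> J) \<inter> {a - 1..b + 1} = {}" by blast
  from class_gf_intervals[OF assms(1) this succ] show ?thesis by (simp add: I)
qed

lemma q_fact_nonzero:
  assumes "\<And>k. 0 < k \<Longrightarrow> x ^ k \<noteq> 1"
  shows "q_fact (x ^ 2) m \<noteq> 0"
proof -
  have "q_int (x ^ 2) k \<noteq> 0" if "0 < k" for k
    using assms[of 2] assms[of "2 * k"] that by (simp add: q_int_def power_mult)
  then show ?thesis by (simp add: q_fact_def)
qed

lemma prod_q_fact_inverse:
  assumes "x \<noteq> 0" "x ^ 2 \<noteq> 1"
  shows "x ^ (\<Sum>d\<leftarrow>ds. d * (d - 1)) * (\<Prod>d\<leftarrow>ds. q_fact (inverse x ^ 2) d) = (\<Prod>d\<leftarrow>ds. q_fact (x ^ 2) d)"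
proof (induction ds)
  case (Cons d ds)
  have "x ^ (\<Sum>d\<leftarrow>d # ds. d * (d - 1)) * (\<Prod>d\<leftarrow>d # ds. q_fact (inverse x ^ 2) d) =
      (x ^ (d * (d - 1)) * q_fact (inverse x ^ 2) d) *
      (x ^ (\<Sum>d\<leftarrow>ds. d * (d - 1)) * (\<Prod>d\<leftarrow>ds. q_fact (inverse x ^ 2) d))"
    by (simp add: power_add mult_ac)
  then show ?case by (simp only: Cons q_fact_inverse[OF assms]) simp
qed simp

text \<open>Components of \<open>I\<close> are cut into pairs directly, those of \<open>J\<close>
  after complementation; there the q-factorials are taken at \<open>1/x\<close>, and
  \<open>x ^ s\<close> converts them. As \<open>x\<close> is not a root of unity, they can be
  cancelled.\<close>

lemma class_gf_unmixed:
  fixes x :: "'a::field"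
  assumes x: "x \<noteq> 0" "\<And>k. 0 < k \<Longrightarrow> x ^ k \<noteq> 1" and "1 \<le> n"
    and I: "I \<subseteq> {1..<n}" "interval_decomp I ivI" and J: "J \<subseteq> {1..<n}" "interval_decomp J ivJ"
    and unmixed: "unmixed I J"
    and bs: "bs = map (\<lambda>(a, b). (card {a..b} + 1) div 2) ivI" and b: "b = sum_list bs"
    and ds: "ds = map (\<lambda>(a, b). (card {a..b} + 1) div 2) ivJ" and d: "d = sum_list ds"
    and M: "M = b + d" and \<alpha>: "\<alpha> = (\<Sum>e\<leftarrow>ds. e ^ 2)"
  shows "class_gf x n I J =
    (if n = 2 * M then
       (- 1) ^ d * x ^ \<alpha> * ((x ^ d * q_int (x ^ 2) b + x ^ b * q_int (x ^ 2) d) / q_int (x ^ 2) M)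
         * q_multinomial (x ^ 2) M (bs @ ds)
     else
       (- x) ^ d * x ^ \<alpha> * q_multinomial (x ^ 2) M (bs @ ds)
         * (\<Prod>k = 2 * M + 2..n. 1 + (- 1) ^ (k - 1) * x ^ (k div 2)))"
proof -
  define A where "A = (\<Union>(a, b)\<in>set ivI. alternate a (b + 1))"
  define B where "B = (\<Union>(a, b)\<in>set ivJ. alternate a (b + 1))"
  have x2: "x ^ 2 \<noteq> 1" using x(2)[of 2] by simp
  have ix2: "inverse x ^ 2 \<noteq> 1" using x2 by (simp add: power_inverse)
  have sub: "A \<subseteq> I" "B \<subseteq> J"
    using alternates_subset I(2) J(2) unfolding A_def B_def by blast+
  have unmixed': "unmixed J A" using sub(1) unmixed unfolding unmixed_def by blast
  have sepA: "separated A" "card A = b" and sepB: "separated B" "card B = d"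
    using alternates_separated_card[of ivI] alternates_separated_card[of ivJ] I(2) J(2)
    unfolding A_def B_def b bs d ds interval_decomp_def by (auto simp: comp_def case_prod_unfold)
  have disj: "A \<inter> B = {}" using sub unmixed unfolding unmixed_def by blast
  have subn: "A \<union> B \<subseteq> {1..<n}" using sub I J by blast
  then have fin: "finite A" "finite B" using finite_subset by blast+
  have "separated (A \<union> B)"
    unfolding separated_def
  proof
    fix i assume "i \<in> A \<union> B"
    then show "i + 1 \<notin> A \<union> B"
    proof
      assume i: "i \<in> A"
      then have "i + 1 \<notin> J" using sub(1) unmixed unfolding unmixed_def by blast
      then show ?thesis using separated_succD[OF sepA(1) i] sub by blast
    next
      assume i: "i \<in> B"
      then have "i + 1 \<notin> I" using sub(2) unmixed unfolding unmixed_def by blast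
      then show ?thesis using separated_succD[OF sepB(1) i] sub by blast
    qed
  qed
  have cardM: "card (A \<union> B) = M" using disj fin sepA sepB M by (simp add: card_Un_disjoint)
  define PI where "PI = (\<Prod>e\<leftarrow>bs. q_fact (x ^ 2) e)"
  define PJ where "PJ = (\<Prod>e\<leftarrow>ds. q_fact (x ^ 2) e)"
  define s where "s = (\<Sum>e\<leftarrow>ds. e * (e - 1))"
  have "class_gf x n A J = PI * class_gf x n I J"
    using class_gf_components[OF x2 I(2,1) unmixed] by (simp add: A_def PI_def bs comp_def case_prod_unfold)
  \<comment> \<open>Complement, merge the components of \<open>J\<close> as ascents, and complement
    back; the prefactor \<open>?w\<close> is the same both times.\<close>
  moreover have "class_gf x n A B = (\<Prod>e\<leftarrow>ds. q_fact (inverse x ^ 2) e) * class_gf x n A J"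
  proof -
    let ?w = "signed_weight x n (\<lambda>i. n - i)"
    have "class_gf x n A B = ?w * class_gf (inverse x) n B A"
      using class_gf_complement[OF x(1), of A n B] subn by blast
    also have "class_gf (inverse x) n B A = (\<Prod>e\<leftarrow>ds. q_fact (inverse x ^ 2) e) * class_gf (inverse x) n J A"
      using class_gf_components[OF ix2 J(2,1) unmixed'] by (simp add: B_def ds comp_def case_prod_unfold)
    also have "?w * ((\<Prod>e\<leftarrow>ds. q_fact (inverse x ^ 2) e) * class_gf (inverse x) n J A) =
        (\<Prod>e\<leftarrow>ds. q_fact (inverse x ^ 2) e) * (?w * class_gf (inverse x) n J A)"
      by (simp add: mult.left_commute)
    also have "?w * class_gf (inverse x) n J A = class_gf x n A J"
      using class_gf_complement[OF x(1), of A n J] subn J(1) by simp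
    finally show ?thesis .
  qed
  ultimately have "x ^ s * class_gf x n A B =
      (x ^ s * (\<Prod>e\<leftarrow>ds. q_fact (inverse x ^ 2) e)) * (PI * class_gf x n I J)"
    by (simp add: mult.assoc)
  then have "x ^ s * class_gf x n A B = PJ * (PI * class_gf x n I J)"
    by (simp only: s_def PJ_def prod_q_fact_inverse[OF x(1) x2])
  moreover have nonzero: "PI \<noteq> 0" "PJ \<noteq> 0"
    unfolding PI_def PJ_def using q_fact_nonzero[OF x(2)] by (auto simp: prod_list_zero_iff)
  ultimately have F: "class_gf x n I J = x ^ s * class_gf x n A B / (PI * PJ)"
    by (simp add: field_simps)
  have \<alpha>': "\<alpha> = s + d"
  proof -
    have "e ^ 2 = e * (e - 1) + e" for e :: nat by (cases e) (auto simp: power2_eq_square)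
    then show ?thesis unfolding \<alpha> s_def d by (simp add: sum_list_addf)
  qed
  have mult: "q_multinomial (x ^ 2) M (bs @ ds) = q_fact (x ^ 2) M / (PI * PJ)"
    by (simp add: q_multinomial_def PI_def PJ_def)
  show ?thesis
  proof (cases "n = 2 * M")
    case True
    then obtain m where m: "M = Suc m" using \<open>1 \<le> n\<close> by (cases M) auto
    have Q: "q_fact (x ^ 2) M = q_int (x ^ 2) M * q_fact (x ^ 2) m" by (simp add: m q_fact_Suc)
    then have nz: "q_int (x ^ 2) M \<noteq> 0" using q_fact_nonzero[OF x(2), of M] by auto
    have AB: "class_gf x n A B = (- x) ^ d * (x ^ d * q_int (x ^ 2) b + x ^ b * q_int (x ^ 2) d) * q_fact (x ^ 2) m"
      using class_gf_separated_full[OF x2 \<open>1 \<le> n\<close> \<open>separated (A \<union> B)\<close> disj subn] True cardM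
      by (simp add: sepA sepB m)
    have "(- x) ^ d = (- 1) ^ d * x ^ d" by (simp flip: power_mult_distrib)
    then show ?thesis
      unfolding if_P[OF True] F AB mult \<alpha>' power_add Q
      using nz nonzero by (simp add: mult_ac)
  next
    case False
    then have "2 * card (A \<union> B) < n"
      using separated_card_le[OF \<open>separated (A \<union> B)\<close> subn] cardM by simp
    then have "class_gf x n A B = (- (x ^ 2)) ^ d * (q_fact (x ^ 2) M *
        (\<Prod>k = 2 * M + 2..n. 1 + (- 1) ^ (k - 1) * x ^ (k div 2)))"
      using class_gf_separated[OF x2 \<open>separated (A \<union> B)\<close> disj subn] by (simp only: cardM sepB)
    moreover have "(- (x ^ 2)) ^ d = (- x) ^ d * x ^ d"
      by (simp add: power2_eq_square flip: power_mult_distrib)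
    ultimately show ?thesis
      using False by (simp add: F mult \<alpha>' power_add mult_ac)
  qed
qed

section \<open>Specialisation to the indeterminate\<close>

lemma xvar_nonzero: "xvar \<noteq> 0"
  by (simp add: xvar_def)

lemma to_fract_power: "to_fract (p ^ k) = to_fract p ^ k"
  by (induction k) simp_all

lemma xvar_power_neq_1:
  assumes "0 < k"
  shows "xvar ^ k \<noteq> 1"
proof
  assume "xvar ^ k = 1"
  then have "to_fract ([:0, 1:] ^ k) = to_fract (1 :: int poly)"
    by (simp only: to_fract_power xvar_def to_fract_1)
  then have "[:0, 1:] ^ k = (1 :: int poly)"
    by (simp only: to_fract_eq_iff)
  \<comment> \<open>At 0 a positive power of the variable vanishes, whereas the constant 1 does
    not.\<close>
  then have "poly ([:0, 1:] ^ k) 0 = (1 :: int)" by simp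
  then show False using assms by (simp add: power_0_left)
qed

theorem theorem4p1:
  fixes n :: nat and I J :: "nat set" and Is Js :: "nat set list"
    and bs ds :: "nat list" and b d M \<alpha> :: nat
  assumes "n \<ge> 1"
    and "I \<subseteq> {1..n - 1}" and "J \<subseteq> {1..n - 1}"
    and "unmixed I J"
    and "connected_components I Is" and "connected_components J Js"
    and "bs = map (\<lambda>C. (card C + 1) div 2) Is"
    and "ds = map (\<lambda>C. (card C + 1) div 2) Js"
    and "b = sum_list bs" and "d = sum_list ds"
    and "M = b + d"
    and "\<alpha> = (\<Sum>e\<leftarrow>ds. e ^ 2)"
  shows "(\<Sum>\<sigma> \<in> descent_class n I J. (- 1) ^ inv_length n \<sigma> * xvar ^ odd_length n \<sigma>) =
    (if n = 2 * M then
       (- 1) ^ d * xvar ^ \<alpha> * ((xvar ^ d * q_int (xvar ^ 2) b + xvar ^ b * q_int (xvar ^ 2) d) / q_int (xvar ^ 2) M)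
         * q_multinomial (xvar ^ 2) M (bs @ ds)
     else
       (- xvar) ^ d * xvar ^ \<alpha> * q_multinomial (xvar ^ 2) M (bs @ ds)
         * (\<Prod>k = 2 * M + 2..n. 1 + (- 1) ^ (k - 1) * xvar ^ (k div 2)))"
proof -
  obtain ivI ivJ where iv: "interval_decomp I ivI" "Is = map (\<lambda>(a, b). {a..b}) ivI"
    "interval_decomp J ivJ" "Js = map (\<lambda>(a, b). {a..b}) ivJ"
    using assms(5,6) by (auto simp: connected_components_def)
  have n: "{1..n - 1} = {1..<n}" using assms(1) by auto
  have "(\<Sum>\<sigma> \<in> descent_class n I J. (- 1) ^ inv_length n \<sigma> * xvar ^ odd_length n \<sigma>) = class_gf xvar n I J"
    by (simp add: descent_class_eq[OF assms(2,3)] class_gf_def signed_weight_def)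
  also note class_gf_unmixed[OF xvar_nonzero xvar_power_neq_1 assms(1) _ iv(1) _ iv(3) assms(4) _ assms(9) _ assms(10-12)]
  finally show ?thesis
    using assms(2,3,7,8) iv(2,4) n by (simp add: comp_def case_prod_unfold)
qed

end
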